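(* Let $K$ be an uncountable algebraically closed field of characteristic zero, $m,n\ge1$, and let $G$ be a differential ideal of $K[[t_1,\ldots,t_m]]\{x_1,\ldots,x_n\}$. Then \[\operatorname{Supp}(\operatorname{Sol}(G))=\operatorname{Sol}(\operatorname{trop}(G)),\] i.e. an $n$-tuple $S$ of subsets of $\mathbb{Z}_{\ge0}^m$ is a solution of $\operatorname{trop}(G)$ if and only if there is a solution $\varphi\in K[[t_1,\ldots,t_m]]^n$ of $G$ with $\operatorname{Supp}(\varphi)=S$.
   Context: Notation: $t^J=t_1^{j_1}\cdots t_m^{j_m}$, $\|J\|_\infty=\max_i j_i$, $\Theta(J)=\partial_{t_1}^{j_1}\cdots\partial_{t_m}^{j_m}$. $K[[t_1,\ldots,t_m]]\{x_1,\ldots,x_n\}$ is the polynomial ring over $K[[t_1,\ldots,t_m]]$ in indeterminates $x_{i,J}$ ($1\le i\le n$, $J\in\mathbb{Z}_{\ge0}^m$), with derivations $\partial_{t_k}$ extended by $\partial_{t_k}x_{i,J}=x_{i,J+e_k}$; a differential ideal is an ideal stable under these derivations. For $\varphi\in K[[t]]^n$, $P(\varphi)$ is obtained by substituting $\Theta(J)\varphi_i$ for $x_{i,J}$; $\operatorname{Sol}(G)=\{\varphi\in K[[t]]^n: P(\varphi)=0\ \forall P\in G\}$. Every $P$ is $P=\sum_{M\in\Delta}\alpha_ME_M$ with $\Delta$ finite, $0\ne\alpha_M\in K[[t]]$, differential monomials $E_M=\prod_{i,\|J\|_\infty\le r}x_{i,J}^{M_{i,J}}$. $\operatorname{Supp}(\sum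 a_Jt^J)=\{J:a_J\ne0\}$, componentwise on tuples. For $X\subseteq\mathbb{Z}_{\ge0}^m$, $\mathcal{N}(X)$ is the convex hull in $\mathbb{R}^m$ of $X+\mathbb{Z}_{\ge0}^m$, $x\in X$ is a vertex if $x\notin\mathcal{N}(X\setminus\{x\})$, $\operatorname{Vert}(X)$ is the set of vertices; $\operatorname{trop}(\psi)=\operatorname{Vert}(\operatorname{Supp}\psi)$. On vertex sets $S\oplus T=\operatorname{Vert}(S\cup T)$, $S\odot T=\operatorname{Vert}(S+T)$ (Minkowski sum). $\Theta_{\operatorname{trop}}(J)T=\{(s_1-j_1,\ldots,s_m-j_m):(s_i)\in T, s_i\ge j_i\ \forall i\}$. For $S=(S_1,\dots,S_n)$, $\epsilon_M(S)=\operatorname{Vert}\bigl(\sum_{i,J}M_{i,J}\Theta_{\operatorname{trop}}(J)S_i\bigr)$ (Minkowski sums, $kX$ the $k$-fold sum, $0X=\{0\}$). $\operatorname{trop}(P)=\bigoplus_{M\in\Delta}a_M\odot\epsilon_M$ with $a_M=\operatorname{trop}(\alpha_M)$, evaluated as $\operatorname{trop}(P)(S)=\operatorname{Vert}\bigl(\bigcup_{M}(a_M+\epsilon_M(S))\bigr)$. $S$ is a solution of $\operatorname{trop}(P)$ if for every $J\in\operatorname{trop}(P)(S)$ there exist $M_1\ne M_2$ in $\Delta$ with $J\in a_{M_1}\odot\epsilon_{M_1}(S)$ and $J\in a_{M_2}\odot\epsilon_{M_2}(S)$. $\operatorname{trop}(G)=\{\operatorname{trop}(P):P\in G\}$ and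 $\operatorname{Sol}(\operatorname{trop}(G))$ is the set of $n$-tuples of subsets of $\mathbb{Z}_{\ge0}^m$ that are solutions of every element of $\operatorname{trop}(G)$. *)

theory Defs
  imports "HOL-Analysis.Analysis" "HOL-Library.Poly_Mapping" "HOL-Library.Countable_Set"
    "HOL-Computational_Algebra.Polynomial"
begin

(* Conventions.
   m = CARD('m), n = CARD('n) for finite (hence nonempty) index types 'm, 'n.
   Exponent vectors J \<in> Z_{\<ge>0}^m : functions 'm \<Rightarrow> nat.
   A power series in K[[t_1..t_m]] : its coefficient function ('m \<Rightarrow> nat) \<Rightarrow> 'a.
   A differential variable x_{i,J} : the pair (i, J) :: 'n \<times> ('m \<Rightarrow> nat).
   A differential monomial E_M : finitely supported exponent map M :: ('n \<times> ('m\<Rightarrow>nat)) \<Rightarrow>\<^sub>0 nat.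
   A differential polynomial P = \<Sum> \<alpha>_M E_M : its coefficient map (monomial \<Rightarrow> series),
   required to have finite support. *)

type_synonym ('m, 'a) series = "('m \<Rightarrow> nat) \<Rightarrow> 'a"
type_synonym ('n, 'm) dmono = "('n \<times> ('m \<Rightarrow> nat)) \<Rightarrow>\<^sub>0 nat"
type_synonym ('n, 'm, 'a) dpoly = "('n, 'm) dmono \<Rightarrow> ('m, 'a) series"

definition series_zero :: "('m, 'a::zero) series" where
  "series_zero = (\<lambda>_. 0)"

definition series_one :: "('m, 'a::{zero,one}) series" where
  "series_one = (\<lambda>J. if (\<forall>i. J i = 0) then 1 else 0)"

definition series_mult :: "('m::finite, 'a::comm_ring_1) series \<Rightarrow> ('m, 'a) series \<Rightarrow> ('m, 'a) series" where
  "series_mult f g = (\<lambda>J. \<Sum>A\<in>{A. \<forall>i. A i \<le> J i}. f A * g (\<lambda>i. J i - A i))"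

definition series_pow :: "('m::finite, 'a::comm_ring_1) series \<Rightarrow> nat \<Rightarrow> ('m, 'a) series" where
  "series_pow f k = (series_mult f ^^ k) series_one"

definition series_deriv :: "'m \<Rightarrow> ('m, 'a::comm_ring_1) series \<Rightarrow> ('m, 'a) series" where
  "series_deriv k f = (\<lambda>J. of_nat (J k + 1) * f (J(k := J k + 1)))"

text \<open>\<Theta>(J) = \<partial>_{t_1}^{j_1} ... \<partial>_{t_m}^{j_m} (the derivations commute).\<close>
definition Theta :: "('m::finite \<Rightarrow> nat) \<Rightarrow> ('m, 'a::comm_ring_1) series \<Rightarrow> ('m, 'a) series" where
  "Theta J f = Finite_Set.fold (\<lambda>k g. (series_deriv k ^^ J k) g) f UNIV"

definition Supp :: "('m, 'a::zero) series \<Rightarrow> ('m \<Rightarrow> nat) set" where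
  "Supp f = {J. f J \<noteq> 0}"

definition dsupp :: "('n, 'm, 'a::zero) dpoly \<Rightarrow> ('n, 'm) dmono set" where
  "dsupp P = {M. P M \<noteq> series_zero}"

definition is_dpoly :: "('n, 'm, 'a::zero) dpoly \<Rightarrow> bool" where
  "is_dpoly P \<longleftrightarrow> finite (dsupp P)"

definition poly_zero :: "('n, 'm, 'a::zero) dpoly" where
  "poly_zero = (\<lambda>_. series_zero)"

definition poly_add :: "('n, 'm, 'a::plus) dpoly \<Rightarrow> ('n, 'm, 'a) dpoly \<Rightarrow> ('n, 'm, 'a) dpoly" where
  "poly_add P Q = (\<lambda>M J. P M J + Q M J)"

definition poly_mul :: "('n, 'm::finite, 'a::comm_ring_1) dpoly \<Rightarrow> ('n, 'm, 'a) dpoly \<Rightarrow> ('n, 'm, 'a) dpoly" where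
  "poly_mul P Q = (\<lambda>N J. \<Sum>p\<in>dsupp P \<times> dsupp Q.
      if fst p + snd p = N then series_mult (P (fst p)) (Q (snd p)) J else 0)"

text \<open>The derivation \<partial>_{t_k} extended to differential polynomials by
  \<partial>_{t_k} x_{i,J} = x_{i,J+e_k} and the Leibniz rule:
  \<partial>(\<alpha>_M E_M) = (\<partial>\<alpha>_M) E_M + \<alpha>_M \<Sum>_{v \<in> Poly_Mapping.keys M} M(v) E_{M - e_v + e_{v+e_k}}.\<close>
definition var_shift :: "'m \<Rightarrow> 'n \<times> ('m \<Rightarrow> nat) \<Rightarrow> 'n \<times> ('m \<Rightarrow> nat)" where
  "var_shift k v = (fst v, (snd v)(k := snd v k + 1))"

definition poly_deriv :: "'m \<Rightarrow> ('n, 'm, 'a::comm_ring_1) dpoly \<Rightarrow> ('n, 'm, 'a) dpoly" where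
  "poly_deriv k P = (\<lambda>N J. series_deriv k (P N) J
      + (\<Sum>M\<in>dsupp P. \<Sum>v\<in>Poly_Mapping.keys M.
           if M - Poly_Mapping.single v 1 + Poly_Mapping.single (var_shift k v) 1 = N
           then of_nat (Poly_Mapping.lookup M v) * P M J else 0))"

definition differential_ideal :: "('n, 'm::finite, 'a::comm_ring_1) dpoly set \<Rightarrow> bool" where
  "differential_ideal G \<longleftrightarrow>
     (\<forall>P\<in>G. is_dpoly P) \<and> poly_zero \<in> G \<and>
     (\<forall>P\<in>G. \<forall>Q\<in>G. poly_add P Q \<in> G) \<and>
     (\<forall>P\<in>G. \<forall>Q. is_dpoly Q \<longrightarrow> poly_mul Q P \<in> G) \<and>
     (\<forall>P\<in>G. \<forall>k. poly_deriv k P \<in> G)"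

definition eval_mono :: "('n, 'm) dmono \<Rightarrow> ('n \<Rightarrow> ('m::finite, 'a::comm_ring_1) series) \<Rightarrow> ('m, 'a) series" where
  "eval_mono M \<phi> = Finite_Set.fold
     (\<lambda>v g. series_mult (series_pow (Theta (snd v) (\<phi> (fst v))) (Poly_Mapping.lookup M v)) g)
     series_one (Poly_Mapping.keys M)"

definition eval_poly :: "('n, 'm::finite, 'a::comm_ring_1) dpoly \<Rightarrow> ('n \<Rightarrow> ('m, 'a) series) \<Rightarrow> ('m, 'a) series" where
  "eval_poly P \<phi> = (\<lambda>J. \<Sum>M\<in>dsupp P. series_mult (P M) (eval_mono M \<phi>) J)"

definition Sol :: "('n, 'm::finite, 'a::comm_ring_1) dpoly set \<Rightarrow> ('n \<Rightarrow> ('m, 'a) series) set" where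
  "Sol G = {\<phi>. \<forall>P\<in>G. eval_poly P \<phi> = series_zero}"

definition to_realvec :: "('m::finite \<Rightarrow> nat) \<Rightarrow> real ^ 'm" where
  "to_realvec J = (\<chi> i. real (J i))"

definition newton :: "('m::finite \<Rightarrow> nat) set \<Rightarrow> (real ^ 'm) set" where
  "newton X = convex hull {to_realvec (\<lambda>i. J i + b i) | J b. J \<in> X}"

definition Vert :: "('m::finite \<Rightarrow> nat) set \<Rightarrow> ('m \<Rightarrow> nat) set" where
  "Vert X = {x \<in> X. to_realvec x \<notin> newton (X - {x})}"

definition trop_series :: "('m::finite, 'a::zero) series \<Rightarrow> ('m \<Rightarrow> nat) set" where
  "trop_series \<psi> = Vert (Supp \<psi>)"

definition minkowski :: "('m \<Rightarrow> nat) set \<Rightarrow> ('m \<Rightarrow> nat) set \<Rightarrow> ('m \<Rightarrow> nat) set" where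
  "minkowski A B = {(\<lambda>i. a i + b i) | a b. a \<in> A \<and> b \<in> B}"

definition mink_pow :: "('m \<Rightarrow> nat) set \<Rightarrow> nat \<Rightarrow> ('m \<Rightarrow> nat) set" where
  "mink_pow X k = (minkowski X ^^ k) {\<lambda>_. 0}"

definition Theta_trop :: "('m \<Rightarrow> nat) \<Rightarrow> ('m \<Rightarrow> nat) set \<Rightarrow> ('m \<Rightarrow> nat) set" where
  "Theta_trop J T = {(\<lambda>i. s i - J i) | s. s \<in> T \<and> (\<forall>i. J i \<le> s i)}"

definition eps :: "('n, 'm::finite) dmono \<Rightarrow> ('n \<Rightarrow> ('m \<Rightarrow> nat) set) \<Rightarrow> ('m \<Rightarrow> nat) set" where
  "eps M S = Vert (Finite_Set.fold
     (\<lambda>v Y. minkowski (mink_pow (Theta_trop (snd v) (S (fst v))) (Poly_Mapping.lookup M v)) Y)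
     {\<lambda>_. 0} (Poly_Mapping.keys M))"

definition trop_term :: "('n, 'm::finite, 'a::zero) dpoly \<Rightarrow> ('n, 'm) dmono \<Rightarrow> ('n \<Rightarrow> ('m \<Rightarrow> nat) set) \<Rightarrow> ('m \<Rightarrow> nat) set" where
  "trop_term P M S = Vert (minkowski (trop_series (P M)) (eps M S))"

definition trop_eval :: "('n, 'm::finite, 'a::zero) dpoly \<Rightarrow> ('n \<Rightarrow> ('m \<Rightarrow> nat) set) \<Rightarrow> ('m \<Rightarrow> nat) set" where
  "trop_eval P S = Vert (\<Union>M\<in>dsupp P. minkowski (trop_series (P M)) (eps M S))"

definition trop_solution :: "('n, 'm::finite, 'a::zero) dpoly \<Rightarrow> ('n \<Rightarrow> ('m \<Rightarrow> nat) set) \<Rightarrow> bool" where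
  "trop_solution P S \<longleftrightarrow>
     (\<forall>J\<in>trop_eval P S. \<exists>M1\<in>dsupp P. \<exists>M2\<in>dsupp P. M1 \<noteq> M2 \<and>
        J \<in> trop_term P M1 S \<and> J \<in> trop_term P M2 S)"

definition Sol_trop :: "('n, 'm::finite, 'a::zero) dpoly set \<Rightarrow> ('n \<Rightarrow> ('m \<Rightarrow> nat) set) set" where
  "Sol_trop G = {S. \<forall>P\<in>G. trop_solution P S}"

end

(* Put t = 0 in the elements of G. As G is closed under the derivations and the characteristic is
   zero, phi solves G if and only if its scaled coefficients c_{i,J} = J! phi_{i,J} satisfy the
   countably many polynomial equations P(0, c) = 0 for P in G. A solution with support S is thus a
   common zero whose nonzero coordinates are exactly those with J in S_i. Since K is uncountable and
   algebraically closed, the Nullstellensatz holds in countably many variables, so such a point exists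
   unless some P(0, x) becomes a single monomial when the variables outside S are set to zero; then
   the origin is a vertex of trop(P)(S) coming from only one monomial, and S is not a solution of
   trop(P). Conversely, if phi solves G, no cancellation can occur at a vertex within one term
   alpha_M E_M(phi), so the vanishing of P(phi) forces each vertex of trop(P)(S) to come from two terms. *)

theory Submission
  imports Defs
begin

text \<open>Two points shape the proof. Tropical terms keep only the vertices of their factors,
  whereas a product of series sees full and possibly infinite supports. The gap is closed by showing
  that the vertices generate the Newton polyhedron and are determined by it, so vertex sets may be
  exchanged for full exponent sets before taking vertices again; \<open>faithful\<close> is the
  invariant carried through products. In the other direction only the origin matters, and there
  taking vertices changes nothing. The Nullstellensatz has to return a point with prescribed nonzero
  coordinates. Hence it does not start from a maximal ideal but from an ideal \<open>Q\<close> that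
  is maximal among those avoiding the set \<open>W\<close> of monomials in these coordinates, in
  effect a maximal ideal after inverting \<open>W\<close>. Uncountability is used as follows: if no
  \<open>x - c\<close> vanished modulo \<open>Q\<close>, the inverses of all these elements would
  live in a space of countable dimension, and a linear relation between them would make
  \<open>x\<close> algebraic.\<close>

section \<open>Newton polyhedra and their vertices\<close>

text \<open>Induction on the set of coordinates. A finite \<open>F\<close> that works on
  \<open>A\<close> can fail at the new coordinate \<open>a\<close> only for points with
  \<open>x a\<close> below the bound \<open>N\<close>; these lie in finitely many slices
  \<open>x a = k\<close>, each covered by the induction hypothesis.\<close>

lemma Dickson_on:
  fixes X :: "('m \<Rightarrow> nat) set"
  assumes "finite A"
  shows "\<exists>F\<subseteq>X. finite F \<and> (\<forall>x\<in>X. \<exists>f\<in>F. \<forall>i\<in>A. f i \<le> x i)"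
  using assms
proof (induction A arbitrary: X rule: finite_induct)
  case empty
  show ?case
  proof (cases "X = {}")
    case False
    then obtain x where "x \<in> X" by blast
    then show ?thesis by (intro exI[of _ "{x}"]) auto
  qed auto
next
  case (insert a A)
  obtain F where F: "F \<subseteq> X" "finite F" "\<And>x. x \<in> X \<Longrightarrow> \<exists>f\<in>F. \<forall>i\<in>A. f i \<le> x i"
    using insert.IH by meson
  obtain N where N: "\<And>f. f \<in> F \<Longrightarrow> f a \<le> N"
    using finite_nat_set_iff_bounded_le[of "(\<lambda>f. f a) ` F"] F(2) by auto
  have "\<forall>k. \<exists>H. H \<subseteq> {x\<in>X. x a = k} \<and> finite H \<and> (\<forall>x\<in>{x\<in>X. x a = k}. \<exists>f\<in>H. \<forall>i\<in>A. f i \<le> x i)"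
    using insert.IH by blast
  then obtain H where H': "\<And>k. H k \<subseteq> {x\<in>X. x a = k} \<and> finite (H k) \<and> (\<forall>x\<in>{x\<in>X. x a = k}. \<exists>f\<in>H k. \<forall>i\<in>A. f i \<le> x i)"
    unfolding choice_iff by blast
  then have H: "\<And>k. H k \<subseteq> {x\<in>X. x a = k}" "\<And>k. finite (H k)"
    "\<And>k x. x \<in> X \<Longrightarrow> x a = k \<Longrightarrow> \<exists>f\<in>H k. \<forall>i\<in>A. f i \<le> x i"
    by blast+
  show ?case
  proof (intro exI[of _ "F \<union> (\<Union>k\<le>N. H k)"] conjI ballI)
    show "F \<union> (\<Union>k\<le>N. H k) \<subseteq> X" using F(1) H(1) by blast
    show "finite (F \<union> (\<Union>k\<le>N. H k))" using F(2) H(2) by auto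
    fix x assume x: "x \<in> X"
    show "\<exists>f\<in>F \<union> (\<Union>k\<le>N. H k). \<forall>i\<in>insert a A. f i \<le> x i"
    proof (cases "x a \<le> N")
      case True
      obtain f where f: "f \<in> H (x a)" "\<forall>i\<in>A. f i \<le> x i" using H(3)[OF x refl] by blast
      have "f a = x a" using H(1) f(1) by blast
      then have "\<forall>i\<in>insert a A. f i \<le> x i" using f(2) by simp
      then show ?thesis using f(1) True by blast
    next
      case False
      obtain f where f: "f \<in> F" "\<forall>i\<in>A. f i \<le> x i" using F(3)[OF x] by blast
      have "\<forall>i\<in>insert a A. f i \<le> x i" using f(2) N[OF f(1)] False by auto
      then show ?thesis using f(1) by blast
    qed
  qed
qed

lemma Dickson:
  fixes X :: "('m::finite \<Rightarrow> nat) set"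
  obtains F where "F \<subseteq> X" "finite F" "\<And>x. x \<in> X \<Longrightarrow> \<exists>f\<in>F. f \<le> x"
  using Dickson_on[of UNIV X] unfolding le_fun_def by (metis UNIV_I finite)

lemma to_realvec_nth [simp]: "to_realvec J $ i = real (J i)"
  by (simp add: to_realvec_def)

lemma to_realvec_eq_iff: "to_realvec x = to_realvec y \<longleftrightarrow> x = y"
  by (auto simp: vec_eq_iff)

lemma to_realvec_add: "to_realvec (\<lambda>i. a i + b i) = to_realvec a + to_realvec b"
  by (simp add: vec_eq_iff)

lemma convex_newton: "convex (newton X)"
  by (simp add: newton_def)

lemma newton_mono: "X \<subseteq> Y \<Longrightarrow> newton X \<subseteq> newton Y"
  unfolding newton_def by (rule hull_mono) blast

lemma newton_member:
  assumes "x \<in> X"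
  shows "to_realvec x \<in> newton X"
proof -
  have "to_realvec x = to_realvec (\<lambda>i. x i + (\<lambda>_. 0) i)" by simp
  then have "to_realvec x \<in> {to_realvec (\<lambda>i. J i + b i) |J b. J \<in> X}"
    using assms by (intro CollectI exI[of _ x] exI[of _ "\<lambda>_. 0"]) simp
  then show ?thesis unfolding newton_def by (rule hull_inc)
qed

text \<open>The generators are integer shifts of \<open>x\<close>; real shifts arise by averaging.
  The point \<open>y\<close> is the mean of points reached from \<open>x\<close> along a single
  axis, each moved by \<open>CARD('m)\<close> times the wanted amount.\<close>

lemma newton_member_ge:
  fixes y :: "real ^ 'm::finite"
  assumes x: "x \<in> X" and y: "\<And>i. real (x i) \<le> y $ i"
  shows "y \<in> newton X"
proof -
  let ?n = "real CARD('m)"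
  define r where "r = (\<lambda>i. ?n * (y $ i - real (x i)))"
  have axis: "to_realvec x + axis i (r i) \<in> newton X" for i
  proof -
    have r0: "r i \<ge> 0" using y[of i] by (simp add: r_def)
    obtain N :: nat where N: "r i < real N" using reals_Archimedean2 by blast
    have N0: "real N > 0" using r0 N by linarith
    have "to_realvec (\<lambda>j. x j + (if j = i then N else 0)) \<in> newton X"
      unfolding newton_def using x by (intro hull_inc) fastforce
    moreover have "to_realvec (\<lambda>j. x j + (if j = i then N else 0)) = to_realvec x + axis i (real N)"
      by (auto simp: vec_eq_iff axis_def)
    ultimately have 1: "to_realvec x + axis i (real N) \<in> newton X" by simp
    have "(1 - r i / real N) *\<^sub>R to_realvec x + (r i / real N) *\<^sub>R (to_realvec x + axis i (real N)) \<in> newton X"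
      using r0 N N0 by (intro convexD[OF convex_newton newton_member[OF x] 1]) (auto simp: field_simps)
    also have "(1 - r i / real N) *\<^sub>R to_realvec x + (r i / real N) *\<^sub>R (to_realvec x + axis i (real N)) = to_realvec x + axis i (r i)"
      using N0 by (auto simp: vec_eq_iff axis_def algebra_simps)
    finally show ?thesis .
  qed
  have "(\<Sum>i\<in>(UNIV::'m set). (1 / ?n) *\<^sub>R (to_realvec x + axis i (r i))) \<in> newton X"
    by (rule convex_sum[OF _ convex_newton]) (use axis in auto)
  also have "(\<Sum>i\<in>(UNIV::'m set). (1 / ?n) *\<^sub>R (to_realvec x + axis i (r i))) = y"
  proof (subst vec_eq_iff, rule allI)
    fix j
    have "(\<Sum>i\<in>(UNIV::'m set). (1 / ?n) *\<^sub>R (to_realvec x + axis i (r i))) $ j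
      = (\<Sum>i\<in>(UNIV::'m set). (1 / ?n) * (real (x j) + (if j = i then r i else 0)))"
      by (simp add: axis_def)
    also have "\<dots> = (1 / ?n) * (?n * real (x j) + r j)"
      by (simp add: sum_distrib_left[symmetric] sum.distrib del: times_divide_eq_left)
    also have "\<dots> = y $ j" by (simp add: r_def field_simps)
    finally show "(\<Sum>i\<in>(UNIV::'m set). (1 / ?n) *\<^sub>R (to_realvec x + axis i (r i))) $ j = y $ j" .
  qed
  finally show ?thesis .
qed

lemma newton_upward:
  assumes p: "p \<in> newton X" and "\<And>i. p $ i \<le> y $ i"
  shows "y \<in> newton X"
proof -
  define r where "r = y - p"
  have r: "r $ i \<ge> 0" for i using assms(2)[of i] by (simp add: r_def)
  have "newton X \<subseteq> {p. p + r \<in> newton X}"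
    unfolding newton_def[of X]
  proof (rule hull_minimal)
    show "{to_realvec (\<lambda>i. J i + b i) |J b. J \<in> X} \<subseteq> {p. p + r \<in> convex hull {to_realvec (\<lambda>i. J i + b i) |J b. J \<in> X}}"
      unfolding newton_def[symmetric]
    proof clarify
      fix J b assume "J \<in> X"
      then show "to_realvec (\<lambda>i. J i + b i) + r \<in> newton X"
        by (rule newton_member_ge) (use r in \<open>auto\<close>)
    qed
    have "{p. p + r \<in> convex hull Z} = (\<lambda>q. (-r) + q) ` (convex hull Z)" for Z
      by (auto simp: image_iff algebra_simps)
    then show "convex {p. p + r \<in> convex hull {to_realvec (\<lambda>i. J i + b i) |J b. J \<in> X}}"
      by (simp add: convex_translation)
  qed
  then show ?thesis using p by (auto simp: r_def)
qed

text \<open>Together with \<open>newton_upward\<close> this characterises \<open>newton X\<close> as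
  the least convex upward-closed set containing \<open>X\<close>, so later inclusions need no
  explicit convex combinations.\<close>

lemma newton_minimal:
  assumes "convex C" "\<And>p y. p \<in> C \<Longrightarrow> (\<And>i. p $ i \<le> y $ i) \<Longrightarrow> y \<in> C"
    and "\<And>x. x \<in> X \<Longrightarrow> to_realvec x \<in> C"
  shows "newton X \<subseteq> C"
  unfolding newton_def
proof (rule hull_minimal)
  show "{to_realvec (\<lambda>i. J i + b i) |J b. J \<in> X} \<subseteq> C"
  proof clarify
    fix J b assume "J \<in> X"
    then show "to_realvec (\<lambda>i. J i + b i) \<in> C"
      by (intro assms(2)[OF assms(3)[of J]]) auto
  qed
qed (rule assms(1))

lemma newton_subset_newton:
  assumes "\<And>x. x \<in> X \<Longrightarrow> to_realvec x \<in> newton Y"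
  shows "newton X \<subseteq> newton Y"
  by (rule newton_minimal) (use convex_newton newton_upward assms in blast)+

text \<open>Minimality is applied to one summand at a time: a translate of a convex upward-closed
  set is again one.\<close>

lemma newton_plus:
  assumes p: "p \<in> newton A" and q: "q \<in> newton B"
  shows "p + q \<in> newton (minkowski A B)"
proof -
  have *: "newton A \<subseteq> {p. p + q \<in> newton C}"
    if "\<And>a. a \<in> A \<Longrightarrow> to_realvec a + q \<in> newton C" for A C :: "('a \<Rightarrow> nat) set" and q
  proof (rule newton_minimal)
    have "{p. p + q \<in> newton C} = (\<lambda>r. (-q) + r) ` newton C"
      by (auto simp: image_iff algebra_simps)
    then show "convex {p. p + q \<in> newton C}"
      by (simp add: convex_translation convex_newton)
    show "y \<in> {p. p + q \<in> newton C}" if "p \<in> {p. p + q \<in> newton C}" "\<And>i. p $ i \<le> y $ i" for p y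
      using that by (auto intro: newton_upward[of "p + q"])
  qed (use that in auto)
  have "to_realvec a + q \<in> newton (minkowski A B)" if a: "a \<in> A" for a
  proof -
    have "newton B \<subseteq> {p. p + to_realvec a \<in> newton (minkowski A B)}"
    proof (rule *)
      fix b assume "b \<in> B"
      then have "(\<lambda>i. a i + b i) \<in> minkowski A B" using a by (auto simp: minkowski_def)
      from newton_member[OF this] show "to_realvec b + to_realvec a \<in> newton (minkowski A B)"
        by (simp add: to_realvec_add add.commute)
    qed
    then show ?thesis using q by (auto simp: add.commute)
  qed
  from *[OF this] show ?thesis using p by blast
qed

lemma Vert_subset: "Vert X \<subseteq> X"
  by (auto simp: Vert_def)

lemma Vert_anti_mono: "x \<in> Vert Y \<Longrightarrow> X \<subseteq> Y \<Longrightarrow> x \<in> X \<Longrightarrow> x \<in> Vert X"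
  using newton_mono[of "X - {x}" "Y - {x}"] by (auto simp: Vert_def)

text \<open>The vertex condition concerns generators only; this upgrades it to extremality in the
  whole polyhedron. Every point of \<open>newton Y\<close> dominates a point on a segment from
  \<open>?x\<close> into \<open>?U\<close>, and these lower points are averaged in place of
  \<open>p\<close> and \<open>q\<close>.\<close>

lemma newton_extreme:
  fixes Y :: "('m::finite \<Rightarrow> nat) set"
  assumes x: "to_realvec x \<notin> newton (Y - {x})"
    and p: "p \<in> newton Y" "p \<noteq> to_realvec x" and q: "q \<in> newton Y" "q \<noteq> to_realvec x"
    and u: "u > 0" "v > 0" "u + v = 1" "u *\<^sub>R p + v *\<^sub>R q = to_realvec x"
  shows False
proof -
  let ?x = "to_realvec x" and ?U = "newton (Y - {x})"
  \<comment> \<open>The alternative \<open>s = 0\<close> covers an empty \<open>?U\<close>, where no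
    \<open>w\<close> can be chosen.\<close>
  have low: "\<exists>s w. 0 \<le> s \<and> (s = 0 \<or> w \<in> ?U) \<and> (\<forall>i. ((1 - s) *\<^sub>R ?x + s *\<^sub>R w) $ i \<le> p $ i)"
    if "p \<in> newton Y" for p
  proof -
    let ?H = "convex hull (insert ?x ?U)"
    define C where "C = {p. \<exists>z\<in>?H. \<forall>i. z $ i \<le> p $ i}"
    have "newton Y \<subseteq> C"
    proof (rule newton_minimal)
      show "convex C"
      proof (rule convexI)
        fix p q :: "real ^ 'm" and u v :: real
        assume uv: "0 \<le> u" "0 \<le> v" "u + v = 1" and "p \<in> C" "q \<in> C"
        then obtain z w where "z \<in> ?H" "\<forall>i. z $ i \<le> p $ i" "w \<in> ?H" "\<forall>i. w $ i \<le> q $ i"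
          by (auto simp: C_def)
        with uv show "u *\<^sub>R p + v *\<^sub>R q \<in> C"
          unfolding C_def
          by (auto intro!: bexI[of _ "u *\<^sub>R z + v *\<^sub>R w"] add_mono mult_left_mono convexD[OF convex_convex_hull])
      qed
      show "y \<in> C" if "p \<in> C" "\<And>i. p $ i \<le> y $ i" for p y
        using that unfolding C_def by (auto intro: order_trans)
      show "to_realvec y \<in> C" if "y \<in> Y" for y
      proof (cases "y = x")
        case True
        then show ?thesis by (auto simp: C_def intro: hull_inc intro!: bexI[of _ ?x])
      next
        case False
        then have "to_realvec y \<in> ?H" using that by (intro hull_inc) (simp add: newton_member)
        then show ?thesis by (auto simp: C_def simp del: to_realvec_nth)
      qed
    qed
    then obtain z where z: "z \<in> ?H" "\<forall>i. z $ i \<le> p $ i" using \<open>p \<in> newton Y\<close> by (auto simp: C_def)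
    show ?thesis
    proof (cases "?U = {}")
      case True
      then show ?thesis using z by (intro exI[of _ 0]) auto
    next
      case False
      then obtain s w where "0 \<le> s" "s \<le> 1" "w \<in> ?U" "z = (1 - s) *\<^sub>R ?x + s *\<^sub>R w"
        using z(1) convex_newton[of "Y - {x}"] by (auto simp: convex_hull_insert hull_same)
          (metis add_diff_cancel_right' add.commute diff_ge_0_iff_ge)
      then show ?thesis using z(2) by blast
    qed
  qed
  obtain s w where sw: "0 \<le> s" "s = 0 \<or> w \<in> ?U" "\<And>i. ((1 - s) *\<^sub>R ?x + s *\<^sub>R w) $ i \<le> p $ i"
    using low[OF p(1)] by blast
  obtain s' w' where sw': "0 \<le> s'" "s' = 0 \<or> w' \<in> ?U" "\<And>i. ((1 - s') *\<^sub>R ?x + s' *\<^sub>R w') $ i \<le> q $ i"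
    using low[OF q(1)] by blast
  have eq: "u * p $ i + v * q $ i = ?x $ i" for i
    using u(4) by (metis vector_add_component vector_scaleR_component real_scaleR_def)
  \<comment> \<open>The weight that the averaged lower points put on \<open>?U\<close>. If it is
    zero, \<open>p\<close> and \<open>q\<close> both dominate their average \<open>?x\<close>, which
    forces \<open>p = ?x\<close>; otherwise dividing by \<open>t\<close> gives a point of
    \<open>?U\<close> below \<open>?x\<close>.\<close>
  define t where "t = u * s + v * s'"
  have t: "u * s \<ge> 0" "v * s' \<ge> 0" using u sw sw' by auto
  have le: "t * ?x $ i \<ge> u * s * w $ i + v * s' * w' $ i" for i
  proof -
    have "u * ((1 - s) * ?x $ i + s * w $ i) + v * ((1 - s') * ?x $ i + s' * w' $ i) \<le> u * p $ i + v * q $ i"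
      using sw(3)[of i] sw'(3)[of i] u by (intro add_mono mult_left_mono) auto
    also have "\<dots> = (u + v) * ?x $ i" using eq[of i] u(3) by simp
    finally show ?thesis by (simp add: t_def algebra_simps)
  qed
  show False
  proof (cases "t = 0")
    case True
    then have "s = 0" "s' = 0" using t u by (auto simp: t_def add_nonneg_eq_0_iff)
    then have ge: "?x $ i \<le> p $ i" "?x $ i \<le> q $ i" for i using sw(3)[of i] sw'(3)[of i] by auto
    have "p $ i = ?x $ i" for i
    proof (rule ccontr)
      assume "p $ i \<noteq> ?x $ i"
      then have "u * ?x $ i < u * p $ i" "v * ?x $ i \<le> v * q $ i" using ge[of i] u by auto
      then have "(u + v) * ?x $ i < u * p $ i + v * q $ i" by (simp add: algebra_simps)
      then show False using eq[of i] u(3) by simp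
    qed
    then show False using p(2) by (simp add: vec_eq_iff)
  next
    case False
    then have t0: "t > 0" using t by (auto simp: t_def)
    define z where "z = (u * s / t) *\<^sub>R w + (v * s' / t) *\<^sub>R w'"
    have "z \<in> ?U"
    proof -
      have one: "u * s / t + v * s' / t = 1" using t0 by (simp add: t_def add_divide_distrib[symmetric])
      consider "w \<in> ?U" "w' \<in> ?U" | "s = 0" "w' \<in> ?U" | "s' = 0" "w \<in> ?U"
        using sw(2) sw'(2) False by (auto simp: t_def)
      then show ?thesis
      proof cases
        case 1
        then show ?thesis unfolding z_def by (intro convexD[OF convex_newton] one) (use t t0 in auto)
      qed (use one in \<open>auto simp: z_def\<close>)
    qed
    moreover have "z $ i \<le> ?x $ i" for i
    proof -
      have "z $ i = (u * s * w $ i + v * s' * w' $ i) / t" by (simp add: z_def add_divide_distrib)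
      then show ?thesis using le[of i] t0 by (simp add: divide_le_eq mult.commute del: to_realvec_nth)
    qed
    ultimately show False using newton_upward assms(1) by blast
  qed
qed

text \<open>Removing an extreme point from \<open>newton Y\<close> leaves a convex upward-closed
  set, so minimality applies to it.\<close>

lemma Vert_newton:
  assumes x: "x \<in> Vert Y" and Z: "\<And>z. z \<in> Z \<Longrightarrow> to_realvec z \<in> newton Y"
  shows "to_realvec x \<notin> newton (Z - {x})"
proof -
  have xY: "to_realvec x \<in> newton Y" and xn: "to_realvec x \<notin> newton (Y - {x})"
    using x newton_member[of x Y] by (auto simp: Vert_def)
  have "newton (Z - {x}) \<subseteq> newton Y - {to_realvec x}"
  proof (rule newton_minimal)
    show "convex (newton Y - {to_realvec x})"
      unfolding convex_def
    proof (intro ballI allI impI)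
      fix p q :: "real^'a" and u v :: real
      assume pq: "p \<in> newton Y - {to_realvec x}" "q \<in> newton Y - {to_realvec x}"
        and uv: "0 \<le> u" "0 \<le> v" "u + v = 1"
      consider "u = 0" "v = 1" | "v = 0" "u = 1" | "u > 0" "v > 0" using uv by fastforce
      then show "u *\<^sub>R p + v *\<^sub>R q \<in> newton Y - {to_realvec x}"
      proof cases
        case 3
        then show ?thesis using newton_extreme[OF xn, of p q u v] pq uv convexD[OF convex_newton, of p Y q u v] by auto
      qed (use pq in auto)
    qed
    fix p y assume p: "p \<in> newton Y - {to_realvec x}" "\<And>i. p $ i \<le> y $ i"
    have "y \<noteq> to_realvec x"
    proof
      assume y: "y = to_realvec x"
      \<comment> \<open>The reflection of \<open>p\<close> in the vertex lies above the vertex,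
        hence in \<open>newton Y\<close>; the vertex would be the midpoint of \<open>p\<close> and
        its reflection.\<close>
      have q: "2 *\<^sub>R y - p \<in> newton Y"
        proof (rule newton_upward[OF xY])
          show "to_realvec x $ i \<le> (2 *\<^sub>R y - p) $ i" for i
            using p(2)[of i] y by simp
        qed
      have "(1/2) *\<^sub>R p + (1/2) *\<^sub>R (2 *\<^sub>R y - p) = to_realvec x" by (simp add: y algebra_simps)
      moreover have "2 *\<^sub>R y - p \<noteq> to_realvec x" using p(1) y by (auto simp: algebra_simps scaleR_2)
      ultimately show False using newton_extreme[OF xn, of p "2 *\<^sub>R y - p" "1/2" "1/2"] p(1) q by auto
    qed
    then show "y \<in> newton Y - {to_realvec x}" using newton_upward p by blast
  qed (use Z in \<open>auto simp: to_realvec_eq_iff\<close>)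
  then show ?thesis by blast
qed

text \<open>Vertices depend only on the polyhedron: \<open>Z\<close> adds no generator outside
  \<open>newton Y\<close>.\<close>

lemma Vert_eq_of_newton:
  assumes YZ: "Y \<subseteq> Z" and Z: "\<And>z. z \<in> Z \<Longrightarrow> to_realvec z \<in> newton Y"
  shows "Vert Y = Vert Z"
proof (intro equalityI subsetI)
  fix x assume x: "x \<in> Vert Y"
  have "x \<in> Z" using x YZ Vert_subset by blast
  moreover have "to_realvec x \<notin> newton (Z - {x})" using Vert_newton[OF x Z] .
  ultimately show "x \<in> Vert Z" by (simp add: Vert_def)
next
  fix x assume x: "x \<in> Vert Z"
  have "x \<in> Y"
  proof (rule ccontr)
    assume "x \<notin> Y"
    then have "newton Y \<subseteq> newton (Z - {x})" using YZ by (intro newton_mono) auto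
    then show False using x Z[of x] by (auto simp: Vert_def)
  qed
  then show "x \<in> Vert Y" using Vert_anti_mono[OF x YZ] by blast
qed

text \<open>Dickson's lemma gives a finite generating subset. In one of least cardinality no element
  is redundant, so all its elements are vertices, and its vertices are those of
  \<open>X\<close>.\<close>

lemma newton_Vert:
  assumes "x \<in> X"
  shows "to_realvec x \<in> newton (Vert X)"
proof -
  let ?P = "\<lambda>F. F \<subseteq> X \<and> finite F \<and> (\<forall>x\<in>X. to_realvec x \<in> newton F)"
  obtain F0 where F0: "F0 \<subseteq> X" "finite F0" "\<And>x. x \<in> X \<Longrightarrow> \<exists>f\<in>F0. f \<le> x"
    using Dickson[of X] by blast
  have "to_realvec x \<in> newton F0" if x: "x \<in> X" for x
  proof -
    obtain f where "f \<in> F0" "f \<le> x" using F0(3)[OF x] by blast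
    then show ?thesis by (intro newton_member_ge[of f]) (auto dest: le_funD)
  qed
  then have "?P F0" using F0(1,2) by simp
  from ex_has_least_nat[of ?P, OF this, of card] obtain F
    where F: "?P F" and "\<forall>H. ?P H \<longrightarrow> card F \<le> card H"
    by (elim exE conjE) simp
  then have min: "card F \<le> card H" if "?P H" for H using that by simp
  have "F \<subseteq> Vert F"
  proof
    fix y assume y: "y \<in> F"
    have "to_realvec y \<notin> newton (F - {y})"
    proof
      assume *: "to_realvec y \<in> newton (F - {y})"
      have "newton F \<subseteq> newton (F - {y})"
        by (rule newton_subset_newton) (metis * Diff_iff newton_member singletonD)
      then have "?P (F - {y})" using F by auto
      from min[OF this] show False using y F by (meson card_Diff1_less leD)
    qed
    then show "y \<in> Vert F" using y by (simp add: Vert_def)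
  qed
  also have "Vert F = Vert X" using F by (intro Vert_eq_of_newton) auto
  finally show ?thesis using F assms newton_mono by blast
qed

section \<open>Vertices of Minkowski sums\<close>

text \<open>With two decompositions, the mixed sums \<open>a + b'\<close> and \<open>a' + b\<close>
  are other points of the Minkowski sum having the vertex as midpoint.\<close>

lemma Vert_minkowski_unique:
  assumes x: "(\<lambda>i. a i + b i) \<in> Vert (minkowski A B)" and "a \<in> A" "b \<in> B" "a' \<in> A" "b' \<in> B"
    and eq: "(\<lambda>i. a i + b i) = (\<lambda>i. a' i + b' i)"
  shows "a = a'"
proof (rule ccontr)
  assume ne: "a \<noteq> a'"
  let ?x = "\<lambda>i. a i + b i"
  have "b \<noteq> b'"
  proof
    assume "b = b'"
    then have "a i = a' i" for i using fun_cong[OF eq, of i] by simp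
    then show False using ne by blast
  qed
  have "(\<lambda>i. a i + b' i) \<noteq> ?x" "(\<lambda>i. a' i + b i) \<noteq> ?x"
    using ne \<open>b \<noteq> b'\<close> unfolding fun_eq_iff by simp_all metis+
  then have m: "(\<lambda>i. a i + b' i) \<in> minkowski A B - {?x}" "(\<lambda>i. a' i + b i) \<in> minkowski A B - {?x}"
    using assms by (auto simp: minkowski_def)
  have "(1/2) *\<^sub>R to_realvec (\<lambda>i. a i + b' i) + (1/2) *\<^sub>R to_realvec (\<lambda>i. a' i + b i) \<in> newton (minkowski A B - {?x})"
    by (intro convexD[OF convex_newton] newton_member m) auto
  also have "(1/2) *\<^sub>R to_realvec (\<lambda>i. a i + b' i) + (1/2) *\<^sub>R to_realvec (\<lambda>i. a' i + b i) = to_realvec ?x"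
  proof (subst vec_eq_iff, rule allI)
    fix i
    have "a i + b i = a' i + b' i" using eq by metis
    then have "real (a i) + real (b i) = real (a' i) + real (b' i)" by (metis of_nat_add)
    then show "((1/2) *\<^sub>R to_realvec (\<lambda>i. a i + b' i) + (1/2) *\<^sub>R to_realvec (\<lambda>i. a' i + b i)) $ i = to_realvec ?x $ i"
      by (simp add: field_simps)
  qed
  finally show False using x by (auto simp: Vert_def)
qed

lemma minkowski_subset_commute: "minkowski A B \<subseteq> minkowski B A"
  unfolding minkowski_def by clarify (metis (no_types) add.commute)

lemma minkowski_commute: "minkowski A B = minkowski B A"
  by (intro equalityI minkowski_subset_commute)

lemma minkowski_left_commute_subset:
  "minkowski A (minkowski B C) \<subseteq> minkowski B (minkowski A C)"
proof
  fix x assume "x \<in> minkowski A (minkowski B C)"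
  then obtain a b c where x: "x = (\<lambda>i. a i + (b i + c i))" and "a \<in> A" "b \<in> B" "c \<in> C"
    by (auto simp: minkowski_def)
  then have "(\<lambda>i. a i + c i) \<in> minkowski A C" by (auto simp: minkowski_def)
  with \<open>b \<in> B\<close> show "x \<in> minkowski B (minkowski A C)"
    unfolding minkowski_def[of B] x
    by (intro CollectI exI[of _ b] exI[of _ "\<lambda>i. a i + c i"]) (simp add: add.left_commute)
qed

lemma minkowski_left_commute: "minkowski A (minkowski B C) = minkowski B (minkowski A C)"
  by (intro equalityI minkowski_left_commute_subset)

text \<open>If \<open>a\<close> lay in the polyhedron of the rest of \<open>A\<close>, translation
  by \<open>b\<close> would place the vertex in the polyhedron of the rest of the sum.\<close>

lemma Vert_minkowski_left:
  assumes x: "(\<lambda>i. a i + b i) \<in> Vert (minkowski A B)" and a: "a \<in> A" and b: "b \<in> B"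
  shows "a \<in> Vert A"
proof -
  have "to_realvec a \<notin> newton (A - {a})"
  proof
    assume "to_realvec a \<in> newton (A - {a})"
    from newton_plus[OF this newton_member[of b "{b}"]]
    have "to_realvec (\<lambda>i. a i + b i) \<in> newton (minkowski (A - {a}) {b})" by (simp add: to_realvec_add)
    also have "\<dots> \<subseteq> newton (minkowski A B - {\<lambda>i. a i + b i})"
    proof (rule newton_mono, rule subsetI)
      fix y assume "y \<in> minkowski (A - {a}) {b}"
      then obtain a' where "a' \<in> A" "a' \<noteq> a" "y = (\<lambda>i. a' i + b i)" by (auto simp: minkowski_def)
      then show "y \<in> minkowski A B - {\<lambda>i. a i + b i}"
        using b by (auto simp: minkowski_def fun_eq_iff)
    qed
    finally show False using x by (auto simp: Vert_def)
  qed
  then show ?thesis using a by (simp add: Vert_def)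
qed

lemma Vert_minkowski_right:
  assumes "(\<lambda>i. a i + b i) \<in> Vert (minkowski A B)" "a \<in> A" "b \<in> B"
  shows "b \<in> Vert B"
  using Vert_minkowski_left[of b a B A] assms by (simp add: minkowski_commute[of A] add.commute)

lemma newton_minkowski_Vert:
  assumes "x \<in> minkowski A B"
  shows "to_realvec x \<in> newton (minkowski (Vert A) (Vert B))"
proof -
  obtain a b where "x = (\<lambda>i. a i + b i)" "a \<in> A" "b \<in> B" using assms by (auto simp: minkowski_def)
  then show ?thesis by (simp add: to_realvec_add newton_plus newton_Vert)
qed

text \<open>This allows the vertex sets in \<open>trop_series\<close> and \<open>eps\<close> to be
  replaced by full supports and full Minkowski sums.\<close>

lemma Vert_minkowski_Vert: "Vert (minkowski (Vert A) (Vert B)) = Vert (minkowski A B)"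
proof (rule Vert_eq_of_newton)
  show "minkowski (Vert A) (Vert B) \<subseteq> minkowski A B"
    using Vert_subset[of A] Vert_subset[of B] unfolding minkowski_def by blast
qed (rule newton_minkowski_Vert)

section \<open>The ring of power series and its derivations\<close>

text \<open>Summing over pairs avoids truncated subtraction: commutativity, associativity and the
  product rule become reindexings.\<close>

definition decomp :: "('m \<Rightarrow> nat) \<Rightarrow> (('m \<Rightarrow> nat) \<times> ('m \<Rightarrow> nat)) set" where
  "decomp J = {(A, B). (\<lambda>i. A i + B i) = J}"

lemma decomp_image: "decomp J = (\<lambda>A. (A, \<lambda>i. J i - A i)) ` {A. \<forall>i. A i \<le> J i}"
proof (intro equalityI subsetI)
  fix p assume "p \<in> decomp J"
  then obtain A B where "p = (A, B)" "(\<lambda>i. A i + B i) = J" by (auto simp: decomp_def)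
  then show "p \<in> (\<lambda>A. (A, \<lambda>i. J i - A i)) ` {A. \<forall>i. A i \<le> J i}" by (intro image_eqI[of _ _ A]) auto
qed (auto simp: decomp_def)

lemma finite_box: "finite {A :: 'm::finite \<Rightarrow> nat. \<forall>i. A i \<le> J i}"
proof (rule finite_subset)
  show "{A. \<forall>i. A i \<le> J i} \<subseteq> PiE UNIV (\<lambda>i. {..J i})" by auto
  show "finite (PiE (UNIV :: 'm set) (\<lambda>i. {..J i}))" by (intro finite_PiE) auto
qed

lemma finite_decomp [simp]: "finite (decomp (J :: 'm::finite \<Rightarrow> nat))"
  by (simp add: decomp_image finite_box)

lemma series_mult_decomp: "series_mult f g J = (\<Sum>(A, B)\<in>decomp J. f A * g B)"
proof -
  have "inj_on (\<lambda>A. (A, \<lambda>i. J i - A i)) {A. \<forall>i. A i \<le> J i}" by (rule inj_onI) simp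
  then show ?thesis by (simp add: series_mult_def decomp_image sum.reindex)
qed

lemma series_mult_commute: "series_mult f g = series_mult g f"
proof
  fix J
  show "series_mult f g J = series_mult g f J"
    unfolding series_mult_decomp
    by (rule sum.reindex_bij_witness[of _ prod.swap prod.swap]) (auto simp: decomp_def mult.commute add.commute)
qed

lemma series_mult_assoc: "series_mult (series_mult f g) h = series_mult f (series_mult g h)"
proof
  fix J
  have "series_mult (series_mult f g) h J = (\<Sum>((A,B),(C,D))\<in>Sigma (decomp J) (\<lambda>p. decomp (fst p)). f C * g D * h B)"
    by (simp add: series_mult_decomp sum_distrib_right sum.Sigma case_prod_beta)
  also have "\<dots> = (\<Sum>((A,B),(C,D))\<in>Sigma (decomp J) (\<lambda>p. decomp (snd p)). f A * (g C * h D))"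
    by (rule sum.reindex_bij_witness[of _
        "\<lambda>((A,B),(C,D)). ((\<lambda>i. A i + C i, D), (A, C))" "\<lambda>((A,B),(C,D)). ((C, \<lambda>i. D i + B i), (D, B))"])
       (auto simp: decomp_def mult.assoc add.assoc)
  also have "\<dots> = series_mult f (series_mult g h) J"
    by (simp add: series_mult_decomp sum_distrib_left sum.Sigma case_prod_beta)
  finally show "series_mult (series_mult f g) h J = series_mult f (series_mult g h) J" .
qed

lemma series_mult_zero_exp:
  fixes f g :: "('a::finite, 'b::comm_ring_1) series"
  shows "series_mult f g (\<lambda>_. 0) = f (\<lambda>_. 0) * g (\<lambda>_. 0)"
proof -
  have "{A. \<forall>i. A i = 0} = {\<lambda>_::'a. 0::nat}" by auto
  then show ?thesis by (simp add: series_mult_def)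
qed

lemma series_mult_one: "series_mult series_one f = f"
proof
  fix J :: "'a \<Rightarrow> nat"
  have "series_mult series_one f J = (\<Sum>A\<in>{\<lambda>_. 0}. series_one A * f (\<lambda>i. J i - A i))"
    unfolding series_mult_def
    by (rule sum.mono_neutral_right[OF finite_box]) (auto simp: series_one_def fun_eq_iff)
  then show "series_mult series_one f J = f J" by (simp add: series_one_def)
qed

lemma series_mult_add: "series_mult (\<lambda>J. f J + g J) h = (\<lambda>J. series_mult f h J + series_mult g h J)"
  by (simp add: fun_eq_iff series_mult_def sum.distrib algebra_simps)

text \<open>Half of the product rule: the factor \<open>of_nat (A k)\<close> kills the pairs with
  \<open>A k = 0\<close>, and lowering \<open>A k\<close> by one matches the others with the pairs
  of \<open>J\<close>.\<close>

lemma series_deriv_mult_aux: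
  fixes J :: "'m::finite \<Rightarrow> nat" and f :: "('m, 'a::comm_ring_1) series"
  shows "(\<Sum>(A, B)\<in>decomp (J(k := J k + 1)). of_nat (A k) * (f A * g B)) = series_mult (series_deriv k f) g J"
proof -
  let ?J = "J(k := J k + 1)"
  have "(\<Sum>(A, B)\<in>decomp ?J. of_nat (A k) * (f A * g B))
      = (\<Sum>(A, B)\<in>{p\<in>decomp ?J. fst p k > 0}. of_nat (A k) * (f A * g B))"
    by (rule sum.mono_neutral_right) (auto, metis gr0I mult_zero_left of_nat_0)
  also have "\<dots> = (\<Sum>(A, B)\<in>decomp J. series_deriv k f A * g B)"
    by (rule sum.reindex_bij_witness[of _ "\<lambda>(A,B). (A(k := A k + 1), B)" "\<lambda>(A,B). (A(k := A k - 1), B)"])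
       (auto simp: decomp_def series_deriv_def fun_eq_iff mult.assoc algebra_simps split: if_splits)
  finally show ?thesis by (simp add: series_mult_decomp)
qed

lemma series_deriv_mult:
  "series_deriv k (series_mult f g) = (\<lambda>J. series_mult (series_deriv k f) g J + series_mult f (series_deriv k g) J)"
proof
  fix J :: "'a \<Rightarrow> nat"
  let ?J = "J(k := J k + 1)"
  have "series_deriv k (series_mult f g) J = (\<Sum>(A, B)\<in>decomp ?J. of_nat (J k + 1) * (f A * g B))"
    by (simp add: series_deriv_def series_mult_decomp sum_distrib_left case_prod_beta)
  \<comment> \<open>The factor \<open>J k + 1\<close> splits as \<open>A k + B k\<close>, one part
    for each term of the product rule.\<close>
  also have "\<dots> = (\<Sum>(A, B)\<in>decomp ?J. of_nat (A k) * (f A * g B) + of_nat (B k) * (f A * g B))"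
  proof (rule sum.cong[OF refl], clarify)
    fix A B assume "(A, B) \<in> decomp ?J"
    then have "(\<lambda>i. A i + B i) = ?J" by (simp add: decomp_def)
    from fun_cong[OF this, of k] have "A k + B k = J k + 1" by simp
    then have "(of_nat (J k + 1) :: 'b) = of_nat (A k) + of_nat (B k)" by (metis of_nat_add)
    then show "of_nat (J k + 1) * (f A * g B) = of_nat (A k) * (f A * g B) + of_nat (B k) * (f A * g B)"
      by (simp add: distrib_right)
  qed
  also have "\<dots> = (\<Sum>(A, B)\<in>decomp ?J. of_nat (A k) * (f A * g B)) + (\<Sum>(A, B)\<in>decomp ?J. of_nat (B k) * (f A * g B))"
    by (simp add: sum.distrib case_prod_beta)
  also have "(\<Sum>(A, B)\<in>decomp ?J. of_nat (B k) * (f A * g B)) = (\<Sum>(A, B)\<in>decomp ?J. of_nat (A k) * (g A * f B))"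
    by (rule sum.reindex_bij_witness[of _ prod.swap prod.swap]) (auto simp: decomp_def ac_simps)
  finally show "series_deriv k (series_mult f g) J = series_mult (series_deriv k f) g J + series_mult f (series_deriv k g) J"
    by (simp only: series_deriv_mult_aux series_mult_commute[of f "series_deriv k g"])
qed

text \<open>A copy of the series as a type of its own, since \<open>*\<close> on functions would not be \<open>series_mult\<close>.\<close>

typedef ('m, 'a) mps = "UNIV :: ('m, 'a) series set"
  morphisms coef Mps by simp

setup_lifting type_definition_mps

instantiation mps :: (finite, comm_ring_1) comm_ring_1
begin

lift_definition zero_mps :: "('a, 'b) mps" is series_zero .
lift_definition one_mps :: "('a, 'b) mps" is series_one .
lift_definition plus_mps :: "('a, 'b) mps \<Rightarrow> ('a, 'b) mps \<Rightarrow> ('a, 'b) mps" is "\<lambda>f g J. f J + g J" .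
lift_definition minus_mps :: "('a, 'b) mps \<Rightarrow> ('a, 'b) mps \<Rightarrow> ('a, 'b) mps" is "\<lambda>f g J. f J - g J" .
lift_definition uminus_mps :: "('a, 'b) mps \<Rightarrow> ('a, 'b) mps" is "\<lambda>f J. - f J" .
lift_definition times_mps :: "('a, 'b) mps \<Rightarrow> ('a, 'b) mps \<Rightarrow> ('a, 'b) mps" is series_mult .

instance
proof
  show "(0 :: ('a, 'b) mps) \<noteq> 1"
  proof transfer
    have "(series_zero :: ('a, 'b) series) (\<lambda>_. 0) \<noteq> series_one (\<lambda>_. 0)"
      by (simp add: series_zero_def series_one_def)
    then show "(series_zero :: ('a, 'b) series) \<noteq> series_one" by metis
  qed
qed (transfer; auto simp: series_zero_def algebra_simps series_mult_assoc series_mult_one series_mult_add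
     intro: series_mult_commute)+

end

lemma Mps_eqI: "(\<And>J. coef f J = coef g J) \<Longrightarrow> f = g"
  by (metis coef_inject ext)

lemma coef_Mps [simp]: "coef (Mps f) = f"
  by (simp add: Mps_inverse)

lemma Mps_series_zero [simp]: "Mps series_zero = 0"
  by (simp add: zero_mps_def)

lemma Mps_mult: "Mps (series_mult f g) = Mps f * Mps g"
  by (simp add: times_mps.abs_eq)

lemma coef_sum: "coef (\<Sum>x\<in>X. f x) J = (\<Sum>x\<in>X. coef (f x) J)"
  by (induction X rule: infinite_finite_induct) (simp_all add: zero_mps.rep_eq plus_mps.rep_eq series_zero_def)

lemma Mps_pow: "Mps (series_pow f k) = Mps f ^ k"
  by (induction k) (simp_all add: series_pow_def Mps_mult one_mps_def)

lemma coef_of_nat_mult: "coef (of_nat n * f) J = of_nat n * coef f J"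
  by (induction n) (simp_all add: zero_mps.rep_eq series_zero_def plus_mps.rep_eq distrib_right)

definition mps_deriv :: "'m \<Rightarrow> ('m, 'a::comm_ring_1) mps \<Rightarrow> ('m, 'a) mps" where
  "mps_deriv k f = Mps (series_deriv k (coef f))"

lemma mps_deriv_add: "mps_deriv k (f + g) = mps_deriv k f + mps_deriv k g"
  by (rule Mps_eqI) (simp add: mps_deriv_def plus_mps.rep_eq series_deriv_def algebra_simps)

lemma mps_deriv_mult: "mps_deriv k (f * g) = mps_deriv k f * g + f * mps_deriv k g"
  by (rule Mps_eqI) (simp add: mps_deriv_def plus_mps.rep_eq times_mps.rep_eq series_deriv_mult)

section \<open>Monomials and derivations in a commutative ring\<close>

text \<open>Generic in the ring, because monomials are evaluated at series, at scalars, and at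
  \<open>Var\<close> and \<open>Const\<close> inside the polynomial ring.\<close>

definition mono_val :: "('v \<Rightarrow> 'r::comm_ring_1) \<Rightarrow> ('v \<Rightarrow>\<^sub>0 nat) \<Rightarrow> 'r" where
  "mono_val y M = (\<Prod>v\<in>Poly_Mapping.keys M. y v ^ Poly_Mapping.lookup M v)"

lemma mono_val_superset:
  assumes "finite V" "Poly_Mapping.keys M \<subseteq> V"
  shows "mono_val y M = (\<Prod>v\<in>V. y v ^ Poly_Mapping.lookup M v)"
  unfolding mono_val_def using assms by (intro prod.mono_neutral_left) (auto simp: in_keys_iff)

lemma mono_val_single [simp]: "mono_val y (Poly_Mapping.single v k) = y v ^ k"
  by (subst mono_val_superset[of "{v}"]) (auto simp: in_keys_iff lookup_single when_def split: if_splits)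

lemma mono_val_add: "mono_val y (M + N) = mono_val y M * mono_val y N"
proof -
  let ?V = "Poly_Mapping.keys M \<union> Poly_Mapping.keys N"
  have "mono_val y (M + N) = (\<Prod>v\<in>?V. y v ^ Poly_Mapping.lookup (M + N) v)"
    using Poly_Mapping.keys_add[of M N] by (intro mono_val_superset) auto
  also have "\<dots> = (\<Prod>v\<in>?V. y v ^ Poly_Mapping.lookup M v) * (\<Prod>v\<in>?V. y v ^ Poly_Mapping.lookup N v)"
    by (simp add: lookup_add power_add prod.distrib)
  also have "\<dots> = mono_val y M * mono_val y N"
    using mono_val_superset[of ?V M y] mono_val_superset[of ?V N y] by simp
  finally show ?thesis .
qed

lemma derivation_one:
  fixes d :: "'r::comm_ring_1 \<Rightarrow> 'r"
  assumes "\<And>a b. d (a * b) = d a * b + a * d b"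
  shows "d 1 = 0"
  using assms[of 1 1] by simp

lemma derivation_power:
  fixes d :: "'r::comm_ring_1 \<Rightarrow> 'r"
  assumes "\<And>a b. d (a * b) = d a * b + a * d b"
  shows "d (a ^ n) = of_nat n * a ^ (n - 1) * d a"
proof (induction n)
  case 0
  show ?case using derivation_one[OF assms] by simp
next
  case (Suc n)
  have "of_nat n * a ^ n = a * (of_nat n * a ^ (n - 1))" by (cases n) simp_all
  then have "a * (of_nat n * a ^ (n - 1) * d a) = of_nat n * a ^ n * d a" by (simp add: mult.assoc)
  then show ?case by (simp add: assms Suc.IH distrib_left distrib_right ac_simps)
qed

lemma derivation_prod:
  fixes d :: "'r::comm_ring_1 \<Rightarrow> 'r"
  assumes d: "\<And>a b. d (a * b) = d a * b + a * d b" and "finite V"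
  shows "d (\<Prod>v\<in>V. f v) = (\<Sum>v\<in>V. d (f v) * (\<Prod>u\<in>V - {v}. f u))"
  using \<open>finite V\<close>
proof induction
  case empty
  show ?case using derivation_one[OF d] by simp
next
  case (insert w V)
  have "(\<Prod>u\<in>insert w V - {v}. f u) = f w * (\<Prod>u\<in>V - {v}. f u)" if "v \<in> V" for v
  proof -
    have "insert w V - {v} = insert w (V - {v})" using insert.hyps that by auto
    then show ?thesis using insert.hyps by simp
  qed
  moreover have "insert w V - {w} = V" using insert.hyps by auto
  ultimately show ?case using insert by (simp add: d sum_distrib_left ac_simps)
qed

text \<open>Arranged to mirror the Leibniz sum in \<open>poly_deriv\<close>. The subtraction loses
  nothing, since \<open>v\<close> is a key of \<open>M\<close>.\<close>

lemma derivation_mono_val: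
  fixes d :: "'r::comm_ring_1 \<Rightarrow> 'r"
  assumes d: "\<And>a b. d (a * b) = d a * b + a * d b"
  shows "d (mono_val y M) = (\<Sum>v\<in>Poly_Mapping.keys M.
    of_nat (Poly_Mapping.lookup M v) * mono_val y (M - Poly_Mapping.single v 1) * d (y v))"
proof -
  let ?V = "Poly_Mapping.keys M"
  have "mono_val y (M - Poly_Mapping.single v 1)
      = y v ^ (Poly_Mapping.lookup M v - 1) * (\<Prod>u\<in>?V - {v}. y u ^ Poly_Mapping.lookup M u)" if v: "v \<in> ?V" for v
  proof -
    have "mono_val y (M - Poly_Mapping.single v 1) = (\<Prod>u\<in>?V. y u ^ Poly_Mapping.lookup (M - Poly_Mapping.single v 1) u)"
      by (rule mono_val_superset) (auto simp: in_keys_iff lookup_minus)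
    moreover have "(\<Prod>u\<in>?V - {v}. y u ^ Poly_Mapping.lookup (M - Poly_Mapping.single v 1) u)
        = (\<Prod>u\<in>?V - {v}. y u ^ Poly_Mapping.lookup M u)"
      by (intro prod.cong refl) (auto simp: lookup_minus lookup_single when_def)
    ultimately show ?thesis
      by (simp add: prod.remove[OF finite_keys v] lookup_minus lookup_single)
  qed
  then show ?thesis
    unfolding mono_val_def[of y M] derivation_prod[OF d finite_keys] derivation_power[OF d]
    by (intro sum.cong refl) (simp add: ac_simps)
qed

section \<open>Iterated derivatives and substitution of series\<close>

text \<open>The rising factorial is \<open>(A k + n)! / (A k)!\<close>. In this closed form
  derivatives in different directions visibly commute, as the fold in \<open>Theta\<close>
  requires.\<close>

lemma series_deriv_funpow:
  "(series_deriv k ^^ n) f = (\<lambda>A. of_nat (pochhammer (Suc (A k)) n) * f (A(k := A k + n)))"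
proof (induction n)
  case 0
  show ?case by simp
next
  case (Suc n)
  have "(series_deriv k ^^ Suc n) f = series_deriv k ((series_deriv k ^^ n) f)" by simp
  also have "\<dots> = (\<lambda>A. of_nat (A k + 1) * (of_nat (pochhammer (Suc (A k + 1)) n) * f (A(k := A k + 1 + n))))"
    unfolding Suc.IH series_deriv_def by simp
  finally show ?case by (simp add: pochhammer_rec[of "Suc _" n] distrib_right mult.assoc fun_upd_def)
qed

lemma Theta_eq:
  fixes f :: "('m::finite, 'a::comm_ring_1) series"
  shows "Theta J f = (\<lambda>A. of_nat (\<Prod>k\<in>UNIV. pochhammer (Suc (A k)) (J k)) * f (\<lambda>i. A i + J i))"
proof -
  let ?g = "\<lambda>k g. (series_deriv k ^^ J k) (g :: ('m, 'a) series)"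
  interpret comp_fun_commute ?g
  proof
    fix k l
    show "?g l \<circ> ?g k = ?g k \<circ> ?g l"
      by (cases "k = l") (auto simp: series_deriv_funpow fun_eq_iff fun_upd_twist ac_simps)
  qed
  \<comment> \<open>Generalised to a finite set \<open>F\<close> of directions already processed;
    only coordinates in \<open>F\<close> are shifted.\<close>
  have "Finite_Set.fold ?g f F
    = (\<lambda>A. of_nat (\<Prod>k\<in>F. pochhammer (Suc (A k)) (J k)) * f (\<lambda>i. if i \<in> F then A i + J i else A i))" if "finite F" for F
    using that
  proof induction
    case (insert k F)
    show ?case
    proof
      fix A
      let ?A = "A(k := A k + J k)"
      have "Finite_Set.fold ?g f (insert k F) = ?g k (Finite_Set.fold ?g f F)"
        by (rule fold_insert[OF insert.hyps])
      then have "Finite_Set.fold ?g f (insert k F) A = of_nat (pochhammer (Suc (A k)) (J k)) *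
          (of_nat (\<Prod>l\<in>F. pochhammer (Suc (?A l)) (J l)) * f (\<lambda>i. if i \<in> F then ?A i + J i else ?A i))"
        unfolding insert.IH by (simp only: series_deriv_funpow)
      also have "(\<Prod>l\<in>F. pochhammer (Suc (?A l)) (J l)) = (\<Prod>l\<in>F. pochhammer (Suc (A l)) (J l))"
        using insert.hyps by (intro prod.cong) auto
      also have "(\<lambda>i. if i \<in> F then ?A i + J i else ?A i) = (\<lambda>i. if i \<in> insert k F then A i + J i else A i)"
        using insert.hyps by auto
      finally show "Finite_Set.fold ?g f (insert k F) A = of_nat (\<Prod>l\<in>insert k F. pochhammer (Suc (A l)) (J l)) *
          f (\<lambda>i. if i \<in> insert k F then A i + J i else A i)"
        using insert.hyps by (simp add: mult.assoc del: insert_iff)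
    qed
  qed simp
  from this[of UNIV] show ?thesis by (simp add: Theta_def)
qed

lemma series_deriv_Theta: "series_deriv k (Theta J f) = Theta (J(k := J k + 1)) f"
proof
  fix A
  let ?p = "\<lambda>A J. \<Prod>l\<in>UNIV - {k}. pochhammer (Suc (A l)) (J l)"
  have split: "(\<Prod>l\<in>UNIV. pochhammer (Suc (A l)) (J l)) = pochhammer (Suc (A k)) (J k) * ?p A J" for A J
    by (subst prod.remove[of _ k]) auto
  have "?p (A(k := A k + 1)) J = ?p A J" "?p A (J(k := J k + 1)) = ?p A J"
    by (auto intro: prod.cong)
  moreover have "(\<lambda>i. (A(k := A k + 1)) i + J i) = (\<lambda>i. A i + (J(k := J k + 1)) i)" by auto
  moreover have "(of_nat (Suc (A k)) :: 'b) * of_nat (pochhammer (Suc (Suc (A k))) (J k)) = of_nat (pochhammer (Suc (A k)) (Suc (J k)))"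
    by (simp add: pochhammer_rec distrib_right)
  ultimately show "series_deriv k (Theta J f) A = Theta (J(k := J k + 1)) f A"
    unfolding series_deriv_def Theta_eq split of_nat_mult mult.assoc[symmetric]
    by (simp del: of_nat_Suc of_nat_add of_nat_prod)
qed

definition jet :: "('n \<Rightarrow> ('m::finite, 'a::comm_ring_1) series) \<Rightarrow> 'n \<times> ('m \<Rightarrow> nat) \<Rightarrow> ('m, 'a) mps" where
  "jet \<phi> v = Mps (Theta (snd v) (\<phi> (fst v)))"

text \<open>The case of a single variable in the compatibility of substitution with the derivations;
  \<open>eval_poly_deriv\<close> extends it by the product rule.\<close>

lemma mps_deriv_jet: "mps_deriv k (jet \<phi> v) = jet \<phi> (var_shift k v)"
  by (simp add: mps_deriv_def jet_def series_deriv_Theta var_shift_def)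

lemma eval_mono_eq: "eval_mono M \<phi> = coef (mono_val (jet \<phi>) M)"
proof -
  let ?h = "\<lambda>v. series_pow (Theta (snd v) (\<phi> (fst v))) (Poly_Mapping.lookup M v)"
  interpret comp_fun_commute "\<lambda>v g. series_mult (?h v) g"
  proof
    fix u v
    have "series_mult (?h u) (series_mult (?h v) g) = series_mult (?h v) (series_mult (?h u) g)" for g
      by (metis series_mult_assoc series_mult_commute)
    then show "series_mult (?h u) \<circ> series_mult (?h v) = series_mult (?h v) \<circ> series_mult (?h u)"
      by (simp add: fun_eq_iff)
  qed
  have "Finite_Set.fold (\<lambda>v g. series_mult (?h v) g) series_one V = coef (\<Prod>v\<in>V. jet \<phi> v ^ Poly_Mapping.lookup M v)"
    if "finite V" for V
    using that
    by induction (simp_all add: one_mps.rep_eq times_mps.rep_eq jet_def Mps_pow[symmetric])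
  then show ?thesis by (simp add: eval_mono_def mono_val_def)
qed

lemma Mps_eval_poly:
  assumes "finite T" "dsupp P \<subseteq> T"
  shows "Mps (eval_poly P \<phi>) = (\<Sum>M\<in>T. Mps (P M) * mono_val (jet \<phi>) M)"
proof -
  have "Mps (eval_poly P \<phi>) = (\<Sum>M\<in>dsupp P. Mps (P M) * mono_val (jet \<phi>) M)"
    by (rule Mps_eqI) (simp add: eval_poly_def eval_mono_eq coef_sum times_mps.rep_eq)
  also have "\<dots> = (\<Sum>M\<in>T. Mps (P M) * mono_val (jet \<phi>) M)"
    using assms by (intro sum.mono_neutral_left) (auto simp: dsupp_def)
  finally show ?thesis .
qed

lemma mps_deriv_zero [simp]: "mps_deriv k 0 = 0"
  using mps_deriv_add[of k 0 0] by simp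

lemma mps_deriv_sum: "mps_deriv k (\<Sum>x\<in>X. f x) = (\<Sum>x\<in>X. mps_deriv k (f x))"
  by (induction X rule: infinite_finite_induct) (simp_all add: mps_deriv_add)

lemma Mps_poly_deriv:
  "Mps (poly_deriv k P N) = mps_deriv k (Mps (P N)) +
     (\<Sum>M\<in>dsupp P. \<Sum>v\<in>Poly_Mapping.keys M.
        if M - Poly_Mapping.single v 1 + Poly_Mapping.single (var_shift k v) 1 = N
        then of_nat (Poly_Mapping.lookup M v) * Mps (P M) else 0)"
  by (rule Mps_eqI)
    (auto simp: poly_deriv_def mps_deriv_def plus_mps.rep_eq coef_sum coef_of_nat_mult zero_mps.rep_eq series_zero_def
      intro!: sum.cong)

lemma eval_poly_deriv:
  assumes "is_dpoly P" "is_dpoly (poly_deriv k P)"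
  shows "eval_poly (poly_deriv k P) \<phi> = series_deriv k (eval_poly P \<phi>)"
proof -
  let ?y = "jet \<phi>" and ?t = "\<lambda>M v. M - Poly_Mapping.single v 1 + Poly_Mapping.single (var_shift k v) 1"
  let ?c = "\<lambda>M v. of_nat (Poly_Mapping.lookup M v) * Mps (P M)"
  \<comment> \<open>One finite index set for all sums: differentiation can both lose monomials of
    \<open>P\<close> and create new ones.\<close>
  define T where "T = dsupp P \<union> dsupp (poly_deriv k P) \<union> (\<Union>M\<in>dsupp P. ?t M ` Poly_Mapping.keys M)"
  have T: "finite T" using assms by (simp add: T_def is_dpoly_def)
  have t: "?t M v \<in> T" if "M \<in> dsupp P" "v \<in> Poly_Mapping.keys M" for M v
    using that by (auto simp: T_def)
  have "Mps (eval_poly (poly_deriv k P) \<phi>) = (\<Sum>N\<in>T. Mps (poly_deriv k P N) * mono_val ?y N)"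
    by (rule Mps_eval_poly[OF T]) (auto simp: T_def)
  also have "\<dots> = (\<Sum>N\<in>T. mps_deriv k (Mps (P N)) * mono_val ?y N)
      + (\<Sum>N\<in>T. \<Sum>M\<in>dsupp P. \<Sum>v\<in>Poly_Mapping.keys M. if ?t M v = N then ?c M v * mono_val ?y N else 0)"
    by (simp add: Mps_poly_deriv distrib_right sum.distrib sum_distrib_right if_distrib[of "\<lambda>x. x * _"] cong: if_cong)
  \<comment> \<open>Summing over \<open>N\<close> innermost lets the condition pick out the single
    index \<open>?t M v\<close>, which \<open>T\<close> contains.\<close>
  also have "(\<Sum>N\<in>T. \<Sum>M\<in>dsupp P. \<Sum>v\<in>Poly_Mapping.keys M. if ?t M v = N then ?c M v * mono_val ?y N else 0)
      = (\<Sum>M\<in>dsupp P. \<Sum>v\<in>Poly_Mapping.keys M. \<Sum>N\<in>T. if ?t M v = N then ?c M v * mono_val ?y N else 0)"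
    by (subst sum.swap, intro sum.cong refl, subst sum.swap, rule refl)
  also have "\<dots> = (\<Sum>M\<in>dsupp P. \<Sum>v\<in>Poly_Mapping.keys M. ?c M v * mono_val ?y (?t M v))"
    using T t by (intro sum.cong refl) (simp add: sum.delta')
  also have "\<dots> = (\<Sum>M\<in>dsupp P. Mps (P M) * mps_deriv k (mono_val ?y M))"
    by (intro sum.cong refl)
      (simp add: derivation_mono_val[where d = "mps_deriv k", OF mps_deriv_mult] mps_deriv_jet mono_val_add sum_distrib_left ac_simps)
  also have "\<dots> = (\<Sum>M\<in>T. Mps (P M) * mps_deriv k (mono_val ?y M))"
    using T by (intro sum.mono_neutral_left) (auto simp: T_def dsupp_def)
  also have "(\<Sum>N\<in>T. mps_deriv k (Mps (P N)) * mono_val ?y N) + \<dots> = mps_deriv k (\<Sum>M\<in>T. Mps (P M) * mono_val ?y M)"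
    by (simp add: mps_deriv_sum mps_deriv_mult sum.distrib)
  also have "(\<Sum>M\<in>T. Mps (P M) * mono_val ?y M) = Mps (eval_poly P \<phi>)"
    by (rule Mps_eval_poly[OF T, symmetric]) (auto simp: T_def)
  finally show ?thesis by (simp add: mps_deriv_def Mps_inject)
qed

text \<open>Taking the constant term respects sums and products, hence commutes with
  substitution.\<close>

lemma eval_poly_at_zero:
  assumes "is_dpoly P"
  shows "eval_poly P \<phi> (\<lambda>_. 0) = (\<Sum>M\<in>dsupp P. P M (\<lambda>_. 0) * mono_val (\<lambda>v. Theta (snd v) (\<phi> (fst v)) (\<lambda>_. 0)) M)"
proof -
  have pow: "coef (f ^ k) (\<lambda>_. 0) = coef f (\<lambda>_. 0) ^ k" for f :: "('b, 'c) mps" and k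
    by (induction k) (simp_all add: one_mps.rep_eq series_one_def times_mps.rep_eq series_mult_zero_exp)
  have prod: "coef (\<Prod>v\<in>V. h v) (\<lambda>_. 0) = (\<Prod>v\<in>V. coef (h v) (\<lambda>_. 0))" for h :: "'d \<Rightarrow> ('b, 'c) mps" and V
    by (induction V rule: infinite_finite_induct)
      (simp_all add: one_mps.rep_eq series_one_def times_mps.rep_eq series_mult_zero_exp)
  have "eval_mono M \<phi> (\<lambda>_. 0) = mono_val (\<lambda>v. Theta (snd v) (\<phi> (fst v)) (\<lambda>_. 0)) M" for M
    by (simp add: eval_mono_eq mono_val_def prod pow jet_def)
  then show ?thesis by (simp add: eval_poly_def series_mult_zero_exp)
qed

text \<open>Induction on the total degree of \<open>J\<close>. The coefficient at \<open>J\<close>,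
  up to a factor nonzero in characteristic zero, is a coefficient of lower degree for
  \<open>poly_deriv k P\<close>; the induction therefore runs over all of \<open>G\<close> at
  once.\<close>

lemma eval_poly_eq_zeroI:
  fixes G :: "('n, 'm::finite, 'a::field_char_0) dpoly set"
  assumes dp: "\<And>P. P \<in> G \<Longrightarrow> is_dpoly P" and dG: "\<And>P k. P \<in> G \<Longrightarrow> poly_deriv k P \<in> G"
    and z: "\<And>P. P \<in> G \<Longrightarrow> eval_poly P \<phi> (\<lambda>_. 0) = 0" and P: "P \<in> G"
  shows "eval_poly P \<phi> = series_zero"
proof -
  have "eval_poly P \<phi> J = 0" if "P \<in> G" "(\<Sum>i\<in>UNIV. J i) = N" for P J N
    using that
  proof (induction N arbitrary: P J)
    case 0
    then have "J = (\<lambda>_. 0)" by (simp add: fun_eq_iff)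
    then show ?case using z 0 by simp
  next
    case (Suc N)
    then obtain k where k: "J k > 0" by (metis gr0I nat.distinct(1) sum.neutral)
    define J' where "J' = J(k := J k - 1)"
    have J: "J = J'(k := J' k + 1)" using k by (simp add: J'_def)
    have "(\<Sum>i\<in>UNIV. J i) = J k + (\<Sum>i\<in>UNIV - {k}. J i)" by (rule sum.remove) auto
    moreover have "(\<Sum>i\<in>UNIV. J' i) = J' k + (\<Sum>i\<in>UNIV - {k}. J' i)" by (rule sum.remove) auto
    moreover have "(\<Sum>i\<in>UNIV - {k}. J' i) = (\<Sum>i\<in>UNIV - {k}. J i)" by (rule sum.cong) (auto simp: J'_def)
    ultimately have "(\<Sum>i\<in>UNIV. J' i) = N" using Suc.prems k by (simp add: J'_def)
    from Suc.IH[OF dG[OF Suc.prems(1), of k] this]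
    have "series_deriv k (eval_poly P \<phi>) J' = 0"
      using eval_poly_deriv[OF dp dp, OF Suc.prems(1) dG[OF Suc.prems(1)]] by metis
    then have "of_nat (J' k + 1) * eval_poly P \<phi> J = 0" unfolding J by (simp add: series_deriv_def)
    then show ?case by (metis add_is_0 mult_eq_0_iff of_nat_eq_0_iff one_neq_zero)
  qed
  then show ?thesis using P by (auto simp: series_zero_def)
qed

section \<open>A Nullstellensatz in countably many variables\<close>

definition is_ideal :: "'r::comm_ring_1 set \<Rightarrow> bool" where
  "is_ideal I \<longleftrightarrow> 0 \<in> I \<and> (\<forall>a\<in>I. \<forall>b\<in>I. a + b \<in> I) \<and> (\<forall>r. \<forall>a\<in>I. r * a \<in> I)"

lemma is_ideal_zero: "is_ideal I \<Longrightarrow> 0 \<in> I"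
  and is_ideal_add: "is_ideal I \<Longrightarrow> a \<in> I \<Longrightarrow> b \<in> I \<Longrightarrow> a + b \<in> I"
  and is_ideal_mult: "is_ideal I \<Longrightarrow> a \<in> I \<Longrightarrow> r * a \<in> I"
  by (simp_all add: is_ideal_def)

lemma is_ideal_minus: "is_ideal I \<Longrightarrow> a \<in> I \<Longrightarrow> - a \<in> I"
  using is_ideal_mult[of I a "-1"] by simp

lemma is_ideal_diff: "is_ideal I \<Longrightarrow> a \<in> I \<Longrightarrow> b \<in> I \<Longrightarrow> a - b \<in> I"
  using is_ideal_add[of I a "- b"] is_ideal_minus[of I b] by simp

lemma is_ideal_sum: "is_ideal I \<Longrightarrow> (\<And>x. x \<in> X \<Longrightarrow> f x \<in> I) \<Longrightarrow> (\<Sum>x\<in>X. f x) \<in> I"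
  by (induction X rule: infinite_finite_induct) (auto simp: is_ideal_zero is_ideal_add)

lemma is_ideal_mult_cong:
  assumes "is_ideal I" "a - b \<in> I" "c - d \<in> I"
  shows "a * c - b * d \<in> I"
proof -
  have "a * c - b * d = c * (a - b) + b * (c - d)" by (simp add: algebra_simps)
  then show ?thesis using assms by (simp add: is_ideal_add is_ideal_mult)
qed

text \<open>Congruences modulo \<open>I\<close> stand in for computations in the quotient
  ring.\<close>

lemma is_ideal_mono_val_cong:
  assumes I: "is_ideal I" and yz: "\<And>v. y v - z v \<in> I"
  shows "mono_val y M - mono_val z M \<in> I"
proof -
  have pow: "y v ^ k - z v ^ k \<in> I" for v k
    by (induction k) (auto simp: is_ideal_zero[OF I] intro: is_ideal_mult_cong[OF I yz])
  have "(\<Prod>v\<in>V. y v ^ k v) - (\<Prod>v\<in>V. z v ^ k v) \<in> I" for k V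
    by (induction V rule: infinite_finite_induct) (auto simp: is_ideal_zero[OF I] intro: is_ideal_mult_cong[OF I pow])
  then show ?thesis by (simp add: mono_val_def)
qed

text \<open>Zorn's lemma; for multiplicatively closed \<open>W\<close>, such a \<open>Q\<close>
  corresponds to a maximal ideal after inverting \<open>W\<close>.\<close>

lemma exists_maximal_ideal_avoiding:
  assumes "is_ideal I" "I \<inter> W = {}"
  obtains Q where "is_ideal Q" "I \<subseteq> Q" "Q \<inter> W = {}"
    "\<And>Q'. is_ideal Q' \<Longrightarrow> Q \<subseteq> Q' \<Longrightarrow> Q' \<inter> W = {} \<Longrightarrow> Q' = Q"
proof -
  define F where "F = {Q. is_ideal Q \<and> I \<subseteq> Q \<and> Q \<inter> W = {}}"
  have "\<exists>Q\<in>F. \<forall>Q'\<in>F. Q \<subseteq> Q' \<longrightarrow> Q' = Q"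
  proof (rule subset_Zorn_nonempty)
    show "F \<noteq> {}" using assms by (auto simp: F_def)
    fix \<C> assume \<C>: "\<C> \<noteq> {}" "subset.chain F \<C>"
    have sub: "\<And>Q. Q \<in> \<C> \<Longrightarrow> Q \<in> F" and tot: "\<And>P Q. P \<in> \<C> \<Longrightarrow> Q \<in> \<C> \<Longrightarrow> P \<subseteq> Q \<or> Q \<subseteq> P"
      using \<C>(2) by (auto simp: subset_chain_def)
    have "a + b \<in> \<Union>\<C>" if ab: "a \<in> \<Union>\<C>" "b \<in> \<Union>\<C>" for a b
    proof -
      obtain P Q where "P \<in> \<C>" "a \<in> P" "Q \<in> \<C>" "b \<in> Q" using ab by blast
      with tot[of P Q] obtain R where "R \<in> \<C>" "a \<in> R" "b \<in> R" by blast
      then show ?thesis using sub[of R] by (auto simp: F_def is_ideal_def)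
    qed
    moreover have "r * a \<in> \<Union>\<C>" if a: "a \<in> \<Union>\<C>" for r a
    proof -
      obtain P where "P \<in> \<C>" "a \<in> P" using a by blast
      then have "r * a \<in> P" using sub[of P] by (simp add: F_def is_ideal_mult)
      then show ?thesis using \<open>P \<in> \<C>\<close> by blast
    qed
    ultimately have "is_ideal (\<Union>\<C>)"
      using \<C>(1) sub by (auto simp: F_def is_ideal_def)
    moreover have "I \<subseteq> \<Union>\<C>" "\<Union>\<C> \<inter> W = {}" using \<C>(1) sub by (auto simp: F_def)
    ultimately show "\<Union>\<C> \<in> F" by (simp add: F_def)
  qed
  then obtain Q where "Q \<in> F" "\<And>Q'. Q' \<in> F \<Longrightarrow> Q \<subseteq> Q' \<Longrightarrow> Q' = Q" by blast
  then show ?thesis by (intro that[of Q]) (auto simp: F_def)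
qed

text \<open>Modulo \<open>Q\<close>, every element outside \<open>Q\<close> divides an element of
  \<open>W\<close>, so it is a unit once \<open>W\<close> is inverted.\<close>

lemma maximal_ideal_avoiding_cofactor:
  assumes Q: "is_ideal Q" and max: "\<And>Q'. is_ideal Q' \<Longrightarrow> Q \<subseteq> Q' \<Longrightarrow> Q' \<inter> W = {} \<Longrightarrow> Q' = Q"
    and a: "a \<notin> Q"
  shows "\<exists>w\<in>W. \<exists>h. w - h * a \<in> Q"
proof (rule ccontr)
  assume *: "\<not> ?thesis"
  \<comment> \<open>The ideal generated by \<open>Q\<close> and \<open>a\<close>; being strictly
    larger than \<open>Q\<close>, it must meet \<open>W\<close>.\<close>
  define Q' where "Q' = {b. \<exists>h. b - h * a \<in> Q}"
  have "is_ideal Q'"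
    unfolding is_ideal_def
  proof (intro conjI ballI allI)
    show "0 \<in> Q'" unfolding Q'_def using is_ideal_zero[OF Q] by (auto intro: exI[of _ 0])
    fix b assume "b \<in> Q'"
    then obtain h where h: "b - h * a \<in> Q" by (auto simp: Q'_def)
    show "r * b \<in> Q'" for r
      using is_ideal_mult[OF Q h, of r] unfolding Q'_def by (auto simp: algebra_simps intro!: exI[of _ "r * h"])
    fix c assume "c \<in> Q'"
    then obtain k where k: "c - k * a \<in> Q" by (auto simp: Q'_def)
    have "b + c - (h + k) * a \<in> Q" using is_ideal_add[OF Q h k] by (simp add: algebra_simps)
    then show "b + c \<in> Q'" unfolding Q'_def by blast
  qed
  moreover have "Q \<subseteq> Q'" unfolding Q'_def by (auto intro: exI[of _ 0])
  moreover have "Q' \<inter> W = {}" using * by (auto simp: Q'_def)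
  ultimately have "Q' = Q" by (rule max)
  moreover have "a \<in> Q'" unfolding Q'_def using is_ideal_zero[OF Q] by (auto intro: exI[of _ 1])
  ultimately show False using a by blast
qed

text \<open>Gaussian elimination: a pivot \<open>e\<close> clears the coordinate \<open>m\<close>,
  at the cost of one vector and one coordinate.\<close>

lemma linear_dependence:
  fixes h :: "'c \<Rightarrow> 'b \<Rightarrow> 'a::field"
  assumes "finite F" "finite C" "card F < card C"
  shows "\<exists>l. (\<exists>c\<in>C. l c \<noteq> 0) \<and> (\<forall>m\<in>F. (\<Sum>c\<in>C. l c * h c m) = 0)"
  using assms
proof (induction F arbitrary: C h rule: finite_induct)
  case empty
  then obtain c where "c \<in> C" by fastforce
  then show ?case by (intro exI[of _ "\<lambda>_. 1"]) auto
next
  case (insert m F)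
  show ?case
  proof (cases "\<forall>c\<in>C. h c m = 0")
    case True
    obtain l where "\<exists>c\<in>C. l c \<noteq> 0" "\<forall>m\<in>F. (\<Sum>c\<in>C. l c * h c m) = 0"
      using insert.IH[of C h] insert.prems insert.hyps by auto
    then show ?thesis using True by (intro exI[of _ l]) auto
  next
    case False
    then obtain e where e: "e \<in> C" "h e m \<noteq> 0" by blast
    define h' where "h' = (\<lambda>c x. h c x - h c m / h e m * h e x)"
    have "card F < card (C - {e})" using insert.prems insert.hyps e by simp
    then obtain l where l: "\<exists>c\<in>C - {e}. l c \<noteq> 0" "\<And>x. x \<in> F \<Longrightarrow> (\<Sum>c\<in>C - {e}. l c * h' c x) = 0"
      using insert.IH[of "C - {e}" h'] insert.prems by auto
    \<comment> \<open>The pivot's coefficient absorbs the multiples of \<open>h e\<close> subtracted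
      in \<open>h'\<close>, so both combinations agree in every coordinate.\<close>
    define l' where "l' = l(e := - (\<Sum>c\<in>C - {e}. l c * (h c m / h e m)))"
    have "(\<Sum>c\<in>C. l' c * h c x) = (\<Sum>c\<in>C - {e}. l c * h' c x)" for x
    proof -
      have "(\<Sum>c\<in>C. l' c * h c x) = l' e * h e x + (\<Sum>c\<in>C - {e}. l' c * h c x)"
        using insert.prems e by (intro sum.remove)
      also have "(\<Sum>c\<in>C - {e}. l' c * h c x) = (\<Sum>c\<in>C - {e}. l c * h c x)"
        by (intro sum.cong) (auto simp: l'_def)
      also have "l' e * h e x = - (\<Sum>c\<in>C - {e}. l c * (h c m / h e m * h e x))"
        by (simp add: l'_def sum_distrib_right mult.assoc)
      finally show ?thesis by (simp add: h'_def right_diff_distrib sum_subtractf)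
    qed
    moreover have "h' c m = 0" for c using e by (simp add: h'_def)
    moreover have "\<exists>c\<in>C. l' c \<noteq> 0" using l(1) by (auto simp: l'_def)
    ultimately show ?thesis using l(2) by (intro exI[of _ l']) simp
  qed
qed

lemma infinite_fibre:
  assumes "uncountable X" "countable Y" "g ` X \<subseteq> Y"
  obtains y where "infinite {x\<in>X. g x = y}"
proof -
  have "X = (\<Union>y\<in>Y. {x\<in>X. g x = y})" using assms(3) by auto
  then show ?thesis using assms(1,2) that by (metis (no_types, lifting) countable_UN countable_finite)
qed

section \<open>Polynomials as finitely supported coefficient maps\<close>

lemma poly_mapping_eq_sum_single:
  "f = (\<Sum>k\<in>Poly_Mapping.keys f. Poly_Mapping.single k (Poly_Mapping.lookup f k))"
proof (rule poly_mapping_eqI)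
  fix k
  show "Poly_Mapping.lookup f k = Poly_Mapping.lookup (\<Sum>k\<in>Poly_Mapping.keys f. Poly_Mapping.single k (Poly_Mapping.lookup f k)) k"
    by (simp add: lookup_sum lookup_single when_def in_keys_iff)
qed

text \<open>The convolution in the form used by \<open>poly_mul\<close>, for comparing the two
  products.\<close>

lemma lookup_mult_keys:
  fixes f g :: "('v \<Rightarrow>\<^sub>0 nat) \<Rightarrow>\<^sub>0 'a::comm_ring_1"
  shows "Poly_Mapping.lookup (f * g) N = (\<Sum>M\<in>Poly_Mapping.keys f. \<Sum>M'\<in>Poly_Mapping.keys g.
    if M + M' = N then Poly_Mapping.lookup f M * Poly_Mapping.lookup g M' else 0)"
proof -
  have "f * g = (\<Sum>M\<in>Poly_Mapping.keys f. Poly_Mapping.single M (Poly_Mapping.lookup f M)) *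
      (\<Sum>M'\<in>Poly_Mapping.keys g. Poly_Mapping.single M' (Poly_Mapping.lookup g M'))"
    using poly_mapping_eq_sum_single[of f] poly_mapping_eq_sum_single[of g] by simp
  also have "\<dots> = (\<Sum>M\<in>Poly_Mapping.keys f. \<Sum>M'\<in>Poly_Mapping.keys g.
      Poly_Mapping.single (M + M') (Poly_Mapping.lookup f M * Poly_Mapping.lookup g M'))"
    by (simp add: sum_product mult_single)
  finally show ?thesis by (simp add: lookup_sum lookup_single when_def)
qed

lemma countable_finite_subsets:
  "countable (UNIV :: 'b set) \<Longrightarrow> countable {F :: 'b set. finite F}"
  using countable_Collect_finite_subset[of "UNIV :: 'b set"] by simp

lemma countable_UNIV_poly_mapping:
  "countable (UNIV :: ('v::countable \<Rightarrow>\<^sub>0 nat) set)"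
proof -
  \<comment> \<open>The graph over the keys determines the map and is a finite subset of a countable
    set.\<close>
  let ?g = "\<lambda>f :: 'v \<Rightarrow>\<^sub>0 nat. (\<lambda>k. (k, Poly_Mapping.lookup f k)) ` Poly_Mapping.keys f"
  have "inj ?g"
  proof (rule injI, rule poly_mapping_eqI)
    fix f g k assume eq: "?g f = ?g g"
    have iff: "Poly_Mapping.lookup f k = n \<and> n \<noteq> 0 \<longleftrightarrow> (k, n) \<in> ?g f" for f :: "'v \<Rightarrow>\<^sub>0 nat" and k n
      by (auto simp: in_keys_iff)
    show "Poly_Mapping.lookup f k = Poly_Mapping.lookup g k"
      using iff[of f k] iff[of g k] eq by metis
  qed
  moreover have "countable (range ?g)"
    by (rule countable_subset[OF _ countable_finite_subsets]) auto
  ultimately show ?thesis using countable_image_inj_on by blast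
qed

abbreviation Const :: "'a::comm_ring_1 \<Rightarrow> ('v \<Rightarrow>\<^sub>0 nat) \<Rightarrow>\<^sub>0 'a" where
  "Const \<equiv> Poly_Mapping.single 0"

abbreviation Var :: "'v \<Rightarrow> ('v \<Rightarrow>\<^sub>0 nat) \<Rightarrow>\<^sub>0 'a::comm_ring_1" where
  "Var v \<equiv> Poly_Mapping.single (Poly_Mapping.single v (Suc 0)) 1"

lemma Const_sum: "(\<Sum>x\<in>X. Const (f x)) = Const (\<Sum>x\<in>X. f x)"
  by (induction X rule: infinite_finite_induct) (simp_all add: single_add)

lemma lookup_Const_mult:
  fixes f :: "('v \<Rightarrow>\<^sub>0 nat) \<Rightarrow>\<^sub>0 'a::comm_ring_1"
  shows "Poly_Mapping.lookup (Const a * f) m = a * Poly_Mapping.lookup f m"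
proof -
  have "Poly_Mapping.lookup (Const a * f) m
      = (\<Sum>M\<in>{0}. \<Sum>M'\<in>Poly_Mapping.keys f. if M + M' = m then Poly_Mapping.lookup (Const a) M * Poly_Mapping.lookup f M' else 0)"
    unfolding lookup_mult_keys by (rule sum.mono_neutral_left) (auto split: if_splits)
  also have "\<dots> = (\<Sum>M'\<in>Poly_Mapping.keys f. if M' = m then a * Poly_Mapping.lookup f m else 0)"
    by (auto intro: sum.cong)
  also have "\<dots> = a * Poly_Mapping.lookup f m"
    by (simp add: sum.delta in_keys_iff)
  finally show ?thesis .
qed

lemma mono_val_Const:
  fixes c :: "'w \<Rightarrow> 'a::comm_ring_1"
  shows "mono_val (\<lambda>v. Const (c v)) M = (Const (mono_val c M) :: ('v \<Rightarrow>\<^sub>0 nat) \<Rightarrow>\<^sub>0 'a)"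
proof -
  have "Const a ^ k = (Const (a ^ k) :: ('v \<Rightarrow>\<^sub>0 nat) \<Rightarrow>\<^sub>0 'a)" for a :: 'a and k
    by (induction k) (simp_all add: mult_single)
  moreover have "(\<Prod>v\<in>V. Const (f v)) = (Const (\<Prod>v\<in>V. f v) :: ('v \<Rightarrow>\<^sub>0 nat) \<Rightarrow>\<^sub>0 'a)"
    for f :: "'w \<Rightarrow> 'a" and V
    by (induction V rule: infinite_finite_induct) (simp_all add: mult_single)
  ultimately show ?thesis by (simp add: mono_val_def)
qed

lemma mono_val_Var:
  "mono_val Var M = (Poly_Mapping.single M 1 :: ('b \<Rightarrow>\<^sub>0 nat) \<Rightarrow>\<^sub>0 'a::comm_ring_1)"
proof -
  have "Var v ^ k = (Poly_Mapping.single (Poly_Mapping.single v k) 1 :: ('b \<Rightarrow>\<^sub>0 nat) \<Rightarrow>\<^sub>0 'a)"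
    for v :: 'b and k
    by (induction k) (simp_all add: mult_single single_add[symmetric])
  moreover have "(\<Prod>v\<in>V. Poly_Mapping.single (f v) 1) = (Poly_Mapping.single (\<Sum>v\<in>V. f v) 1 :: ('b \<Rightarrow>\<^sub>0 nat) \<Rightarrow>\<^sub>0 'a)"
    for f :: "'b \<Rightarrow> 'b \<Rightarrow>\<^sub>0 nat" and V
    by (induction V rule: infinite_finite_induct) (simp_all add: mult_single)
  ultimately show ?thesis using poly_mapping_eq_sum_single[of M] by (simp add: mono_val_def)
qed

text \<open>Univariate polynomials split over the field; substituting a multivariate
  \<open>x\<close> carries their linear factors to elements \<open>x - Const b\<close>.\<close>

definition subst_poly :: "'a::comm_ring_1 poly \<Rightarrow> (('v \<Rightarrow>\<^sub>0 nat) \<Rightarrow>\<^sub>0 'a) \<Rightarrow> ('v \<Rightarrow>\<^sub>0 nat) \<Rightarrow>\<^sub>0 'a" where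
  "subst_poly p x = poly (map_poly Const p) x"

lemma subst_poly_0 [simp]: "subst_poly 0 x = 0"
  by (simp add: subst_poly_def)

lemma subst_poly_pCons: "subst_poly (pCons a p) x = Const a + x * subst_poly p x"
  by (simp add: subst_poly_def map_poly_pCons)

lemma subst_poly_add:
  fixes x :: "('v \<Rightarrow>\<^sub>0 nat) \<Rightarrow>\<^sub>0 'a::comm_ring_1"
  shows "subst_poly (p + q) x = subst_poly p x + subst_poly q x"
proof -
  have "map_poly Const (p + q) = map_poly Const p + (map_poly Const q :: (('v \<Rightarrow>\<^sub>0 nat) \<Rightarrow>\<^sub>0 'a) poly)"
    by (rule poly_eqI) (simp add: coeff_map_poly single_add)
  then show ?thesis by (simp add: subst_poly_def)
qed

lemma subst_poly_smult:
  fixes x :: "('v \<Rightarrow>\<^sub>0 nat) \<Rightarrow>\<^sub>0 'a::comm_ring_1"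
  shows "subst_poly (smult a p) x = Const a * subst_poly p x"
proof -
  have "map_poly Const (smult a p) = smult (Const a) (map_poly Const p :: (('v \<Rightarrow>\<^sub>0 nat) \<Rightarrow>\<^sub>0 'a) poly)"
    by (rule poly_eqI) (simp add: coeff_map_poly mult_single)
  then show ?thesis by (simp add: subst_poly_def)
qed

lemma subst_poly_mult: "subst_poly (p * q) x = subst_poly p x * subst_poly q x"
  by (induction p) (simp_all add: subst_poly_pCons subst_poly_add subst_poly_smult algebra_simps)

lemma subst_poly_linear: "subst_poly [:- b, 1:] x = x - Const b"
  by (simp add: subst_poly_pCons single_uminus)

lemma subst_poly_sum: "subst_poly (\<Sum>c\<in>X. f c) x = (\<Sum>c\<in>X. subst_poly (f c) x)"
  by (induction X rule: infinite_finite_induct) (simp_all add: subst_poly_add)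

lemma subst_poly_1 [simp]: "subst_poly 1 x = 1"
  by (simp add: one_pCons subst_poly_pCons)

lemma subst_poly_prod_linear: "subst_poly (\<Prod>c\<in>X. [:- c, 1:]) x = (\<Prod>c\<in>X. x - Const c)"
  by (induction X rule: infinite_finite_induct)
    (simp_all add: subst_poly_mult subst_poly_linear del: mult_pCons_left)

text \<open>If no \<open>x - c\<close> is in \<open>Q\<close>, then the uncountably many cofactors \<open>h c\<close> live in countably
  many finite-dimensional spaces, and a linear dependence between them yields a nonzero univariate
  polynomial \<open>q\<close> and \<open>u \<in> W\<close> with \<open>u * q(x) \<in> Q\<close>; splitting \<open>q\<close> into linear factors
  contradicts \<open>Q \<inter> W = {}\<close>.\<close>

lemma exists_residue:
  fixes Q :: "(('v::countable \<Rightarrow>\<^sub>0 nat) \<Rightarrow>\<^sub>0 'a::alg_closed_field) set"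
  assumes unc: "uncountable (UNIV :: 'a set)" and Q: "is_ideal Q" and QW: "Q \<inter> W = {}"
    and max: "\<And>Q'. is_ideal Q' \<Longrightarrow> Q \<subseteq> Q' \<Longrightarrow> Q' \<inter> W = {} \<Longrightarrow> Q' = Q"
    and W: "countable W" "\<And>a b. a \<in> W \<Longrightarrow> b \<in> W \<Longrightarrow> a * b \<in> W"
  shows "\<exists>c. x - Const c \<in> Q"
proof (rule ccontr)
  assume "\<not> ?thesis"
  then have "\<forall>c. \<exists>w h. w \<in> W \<and> w - h * (x - Const c) \<in> Q"
    using maximal_ideal_avoiding_cofactor[OF Q max] by blast
  then obtain w h where w: "\<And>c. w c \<in> W" and h: "\<And>c. w c - h c * (x - Const c) \<in> Q" by metis

  \<comment> \<open>Induction on the degree strips one root \<open>b\<close> at a time: modulo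
    \<open>Q\<close>, multiplying by \<open>h b\<close> turns the factor \<open>x - Const b\<close>
    into \<open>w b\<close>, which is absorbed into \<open>u\<close>.\<close>
  have nz: "u * subst_poly q x \<notin> Q" if "q \<noteq> 0" "u \<in> W" for q u
    using that
  proof (induction "degree q" arbitrary: q u)
    case 0
    then obtain a where a: "q = [:a:]" "a \<noteq> 0" by (metis degree_eq_zeroE pCons_0_0)
    have "Const (inverse a) * (u * subst_poly q x) = (Const (inverse a) * Const a) * u"
      using a by (simp add: subst_poly_pCons ac_simps)
    also have "\<dots> = u" using a by (simp add: mult_single)
    finally have "Const (inverse a) * (u * subst_poly q x) = u" .
    then show ?case using is_ideal_mult[OF Q, of "u * subst_poly q x" "Const (inverse a)"] QW 0 by auto
  next
    case (Suc n)
    then obtain b where "poly q b = 0" using alg_closed_imp_poly_has_root[of q] by auto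
    then obtain p where p: "q = [:- b, 1:] * p" by (metis poly_eq_0_iff_dvd dvdE)
    have p0: "p \<noteq> 0" using p Suc.prems by auto
    have "degree q = Suc (degree p)" unfolding p using p0 by (subst degree_mult_eq) auto
    then have deg: "n = degree p" using Suc.hyps by simp
    show ?case
    proof
      assume "u * subst_poly q x \<in> Q"
      then have "h b * (u * subst_poly q x) \<in> Q" by (rule is_ideal_mult[OF Q])
      moreover have "(u * subst_poly p x) * (w b - h b * (x - Const b)) \<in> Q"
        by (rule is_ideal_mult[OF Q h])
      ultimately have "(u * subst_poly p x) * (w b - h b * (x - Const b)) + h b * (u * subst_poly q x) \<in> Q"
        using is_ideal_add[OF Q] by blast
      also have "(u * subst_poly p x) * (w b - h b * (x - Const b)) + h b * (u * subst_poly q x)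
          = (w b * u) * subst_poly p x"
        unfolding p subst_poly_mult subst_poly_linear by (simp add: algebra_simps)
      finally show False using Suc.hyps(1)[OF deg p0 W(2)[OF w Suc.prems(2)]] by blast
    qed
  qed

  \<comment> \<open>Countably many labels for uncountably many \<open>c\<close> leave an infinite
    fibre. On it the \<open>h c\<close> share a finite key set \<open>F\<close>, so any
    \<open>card F + 1\<close> of them are linearly dependent.\<close>
  let ?m = "\<lambda>c. (w c, Poly_Mapping.keys (h c))"
  have "countable (W \<times> {F :: ('v \<Rightarrow>\<^sub>0 nat) set. finite F})"
    using W(1) countable_finite_subsets[OF countable_UNIV_poly_mapping] by (rule countable_SIGMA)
  moreover have "range ?m \<subseteq> W \<times> {F. finite F}" using w by auto
  ultimately obtain z where "infinite {c \<in> UNIV. ?m c = z}" using infinite_fibre[OF unc] by blast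
  then obtain u F where inf: "infinite {c. w c = u \<and> Poly_Mapping.keys (h c) = F}"
    by (cases z) auto
  then obtain B where B: "B \<subseteq> {c. w c = u \<and> Poly_Mapping.keys (h c) = F}" "finite B" "card B = Suc (card F)"
    by (meson infinite_arbitrarily_large)
  have wB: "w c = u" and hB: "Poly_Mapping.keys (h c) = F" if "c \<in> B" for c using B(1) that by auto
  obtain c1 where c1: "c1 \<in> B" using B(3) by fastforce
  have finF: "finite F" using hB[OF c1] finite_keys by metis
  obtain l where l: "\<exists>c\<in>B. l c \<noteq> 0" "\<And>m. m \<in> F \<Longrightarrow> (\<Sum>c\<in>B. l c * Poly_Mapping.lookup (h c) m) = 0"
    using linear_dependence[OF finF B(2), of "\<lambda>c. Poly_Mapping.lookup (h c)"] B(3) by auto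
  have dep: "(\<Sum>c\<in>B. Const (l c) * h c) = 0"
  proof (rule poly_mapping_eqI)
    fix m
    have "Poly_Mapping.lookup (\<Sum>c\<in>B. Const (l c) * h c) m = (\<Sum>c\<in>B. l c * Poly_Mapping.lookup (h c) m)"
      by (simp add: lookup_sum lookup_Const_mult)
    also have "\<dots> = 0"
    proof (cases "m \<in> F")
      case False
      then have "Poly_Mapping.lookup (h c) m = 0" if "c \<in> B" for c
        using hB[OF that] by (simp add: in_keys_iff[symmetric] flip: not_in_keys_iff_lookup_eq_zero)
      then show ?thesis by simp
    qed (rule l(2))
    finally show "Poly_Mapping.lookup (\<Sum>c\<in>B. Const (l c) * h c) m = Poly_Mapping.lookup 0 m" by simp
  qed

  \<comment> \<open>Modulo \<open>Q\<close>, \<open>h c\<close> acts like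
    \<open>u / (x - c)\<close>, and \<open>q\<close> is the numerator of the sum of the
    \<open>l c / (x - c)\<close> over a common denominator. At a point \<open>e\<close> with
    \<open>l e \<noteq> 0\<close> only the summand of \<open>e\<close> survives, so \<open>q\<close>
    is nonzero.\<close>
  define q where "q = (\<Sum>c\<in>B. smult (l c) (\<Prod>d\<in>B - {c}. [:- d, 1:]))"
  obtain e where e: "e \<in> B" "l e \<noteq> 0" using l(1) by blast
  have "poly q e = (\<Sum>c\<in>B. l c * (\<Prod>d\<in>B - {c}. e - d))"
    by (simp add: q_def poly_sum poly_prod)
  also have "\<dots> = (\<Sum>c\<in>{e}. l c * (\<Prod>d\<in>B - {c}. e - d))"
    using B(2) e by (intro sum.mono_neutral_right) (auto intro!: prod_zero)
  also have "\<dots> \<noteq> 0" using B(2) e by simp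
  finally have "q \<noteq> 0" by auto
  moreover have "u * subst_poly q x \<in> Q"
  proof -
    let ?P = "\<lambda>c. \<Prod>d\<in>B - {c}. x - Const d"
    have "(\<Sum>c\<in>B. (Const (l c) * ?P c) * (u - h c * (x - Const c))) \<in> Q"
      using wB h by (intro is_ideal_sum[OF Q] is_ideal_mult[OF Q]) metis
    also have "(\<Sum>c\<in>B. (Const (l c) * ?P c) * (u - h c * (x - Const c)))
        = (\<Sum>c\<in>B. u * (Const (l c) * ?P c)) - (\<Sum>c\<in>B. Const (l c) * h c * (\<Prod>d\<in>B. x - Const d))"
      by (simp add: sum_subtractf[symmetric] prod.remove[OF B(2), of _ "\<lambda>d. x - Const d"] algebra_simps cong: sum.cong)
    also have "(\<Sum>c\<in>B. Const (l c) * h c * (\<Prod>d\<in>B. x - Const d)) = 0"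
      using dep by (simp add: sum_distrib_right[symmetric])
    also have "(\<Sum>c\<in>B. u * (Const (l c) * ?P c)) = u * subst_poly q x"
      by (simp add: q_def subst_poly_sum subst_poly_smult subst_poly_prod_linear sum_distrib_left)
    finally show ?thesis by simp
  qed
  ultimately show False using nz[of q u] w[of c1] wB[OF c1] by auto
qed

text \<open>For empty \<open>S\<close> the hypothesis says that \<open>I\<close> is proper.
  Otherwise it says that \<open>I\<close> stays proper after inverting the variables in
  \<open>S\<close>, which are then forced to be nonzero at the point found.\<close>

lemma torus_Nullstellensatz:
  fixes I :: "(('v::countable \<Rightarrow>\<^sub>0 nat) \<Rightarrow>\<^sub>0 'a::alg_closed_field) set"
  assumes unc: "uncountable (UNIV :: 'a set)" and I: "is_ideal I"
    and mono: "\<And>M. Poly_Mapping.keys M \<subseteq> S \<Longrightarrow> Poly_Mapping.single M 1 \<notin> I"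
  shows "\<exists>c. (\<forall>v\<in>S. c v \<noteq> 0) \<and>
    (\<forall>f\<in>I. (\<Sum>M\<in>Poly_Mapping.keys f. Poly_Mapping.lookup f M * mono_val c M) = 0)"
proof -
  define W where "W = (\<lambda>M. Poly_Mapping.single M (1::'a)) ` {M :: 'v \<Rightarrow>\<^sub>0 nat. Poly_Mapping.keys M \<subseteq> S}"
  have cW: "countable W"
    unfolding W_def using countable_subset[OF subset_UNIV countable_UNIV_poly_mapping] by (rule countable_image)
  have W1: "1 \<in> W" unfolding W_def by (intro image_eqI[of _ _ 0]) auto
  have WX: "Var v \<in> W" if "v \<in> S" for v using that by (auto simp: W_def)
  have mW: "a * b \<in> W" if ab: "a \<in> W" "b \<in> W" for a b
  proof -
    obtain M N where "a = Poly_Mapping.single M 1" "b = Poly_Mapping.single N 1"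
      "Poly_Mapping.keys M \<subseteq> S" "Poly_Mapping.keys N \<subseteq> S" using ab unfolding W_def by blast
    then show ?thesis
      using Poly_Mapping.keys_add[of M N] by (auto simp: W_def mult_single intro!: image_eqI[of _ _ "M + N"])
  qed
  have "I \<inter> W = {}" using mono by (auto simp: W_def)
  from exists_maximal_ideal_avoiding[OF I this]
  obtain Q where Q: "is_ideal Q" "I \<subseteq> Q" and QW: "Q \<inter> W = {}"
    and max: "\<And>Q'. is_ideal Q' \<Longrightarrow> Q \<subseteq> Q' \<Longrightarrow> Q' \<inter> W = {} \<Longrightarrow> Q' = Q" by metis
  have "\<exists>c. Var v - Const c \<in> Q" for v
    by (rule exists_residue[OF unc Q(1) QW max cW mW])
  then obtain c where c: "\<And>v. Var v - Const (c v) \<in> Q" by metis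
  \<comment> \<open>Residues are scalars; since \<open>1\<close> lies in \<open>W\<close>, no
    nonzero scalar vanishes modulo \<open>Q\<close>.\<close>
  have const: "a = 0" if "Const a \<in> Q" for a
  proof (rule ccontr)
    assume "a \<noteq> 0"
    then have "Const (inverse a) * Const a = (1 :: ('v \<Rightarrow>\<^sub>0 nat) \<Rightarrow>\<^sub>0 'a)" by (simp add: mult_single)
    then show False using is_ideal_mult[OF Q(1) that, of "Const (inverse a)"] QW W1 by auto
  qed
  show ?thesis
  proof (intro exI[of _ c] conjI ballI)
    fix v assume "v \<in> S"
    \<comment> \<open>If \<open>c v\<close> were zero, \<open>Var v\<close> itself would lie in both
      \<open>Q\<close> and \<open>W\<close>.\<close>
    then show "c v \<noteq> 0" using c[of v] WX[of v] QW by auto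
  next
    fix f assume f: "f \<in> I"
    let ?r = "\<Sum>M\<in>Poly_Mapping.keys f. Poly_Mapping.lookup f M * mono_val c M"
    have "Poly_Mapping.single M 1 - Const (mono_val c M) \<in> Q" for M
      using is_ideal_mono_val_cong[OF Q(1), of Var "\<lambda>v. Const (c v)" M] c by (simp add: mono_val_Var mono_val_Const)
    then have "(\<Sum>M\<in>Poly_Mapping.keys f. Const (Poly_Mapping.lookup f M) * (Poly_Mapping.single M 1 - Const (mono_val c M))) \<in> Q"
      by (intro is_ideal_sum[OF Q(1)] is_ideal_mult[OF Q(1)])
    also have "(\<Sum>M\<in>Poly_Mapping.keys f. Const (Poly_Mapping.lookup f M) * (Poly_Mapping.single M 1 - Const (mono_val c M)))
        = (\<Sum>M\<in>Poly_Mapping.keys f. Poly_Mapping.single M (Poly_Mapping.lookup f M)) - Const ?r"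
      by (simp add: right_diff_distrib mult_single sum_subtractf Const_sum)
    also have "\<dots> = f - Const ?r" using poly_mapping_eq_sum_single[of f] by simp
    finally have "f - Const ?r \<in> Q" .
    then have "Const ?r \<in> Q" using is_ideal_diff[OF Q(1), of f "f - Const ?r"] f Q(2) by auto
    then show "?r = 0" by (rule const)
  qed
qed

section \<open>Tropical solutions and supports\<close>

text \<open>The half-space of coordinate sum at least 1 contains all other exponents and excludes
  the origin. Thus every tropical operation can be tested at the origin without its
  \<open>Vert\<close>.\<close>

lemma zero_mem_Vert: "(\<lambda>_. 0) \<in> Vert X \<longleftrightarrow> (\<lambda>_. 0) \<in> X"
proof -
  let ?z = "\<lambda>_::'a. 0::nat"
  have "newton (X - {?z}) \<subseteq> {p. 1 \<le> (\<Sum>i\<in>UNIV. p $ i)}"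
  proof (rule newton_minimal)
    show "convex {p :: real ^ 'a. 1 \<le> (\<Sum>i\<in>UNIV. p $ i)}"
    proof (rule convexI, clarify)
      fix p q :: "real ^ 'a" and u v :: real
      assume uv: "0 \<le> u" "0 \<le> v" "u + v = 1" and "1 \<le> (\<Sum>i\<in>UNIV. p $ i)" "1 \<le> (\<Sum>i\<in>UNIV. q $ i)"
      then have "u * 1 + v * 1 \<le> u * (\<Sum>i\<in>UNIV. p $ i) + v * (\<Sum>i\<in>UNIV. q $ i)"
        by (intro add_mono mult_left_mono)
      then show "1 \<le> (\<Sum>i\<in>UNIV. (u *\<^sub>R p + v *\<^sub>R q) $ i)"
        using uv by (simp add: sum.distrib sum_distrib_left)
    qed
    show "y \<in> {p. 1 \<le> (\<Sum>i\<in>UNIV. p $ i)}"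
      if "p \<in> {p. 1 \<le> (\<Sum>i\<in>UNIV. p $ i)}" "\<And>i. p $ i \<le> y $ i" for p y :: "real ^ 'a"
      using that sum_mono[of UNIV "\<lambda>i. p $ i" "\<lambda>i. y $ i"] by fastforce
    show "to_realvec x \<in> {p. 1 \<le> (\<Sum>i\<in>UNIV. p $ i)}" if "x \<in> X - {?z}" for x
    proof -
      have "(\<Sum>i\<in>UNIV. x i) \<noteq> 0" using that by auto
      then have "1 \<le> real (\<Sum>i\<in>UNIV. x i)" by linarith
      then show ?thesis by simp
    qed
  qed
  moreover have "to_realvec ?z \<notin> {p. 1 \<le> (\<Sum>i\<in>UNIV. p $ i)}" by simp
  ultimately show ?thesis by (auto simp: Vert_def)
qed

lemma minkowskiI: "a \<in> A \<Longrightarrow> b \<in> B \<Longrightarrow> (\<lambda>i. a i + b i) \<in> minkowski A B"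
  unfolding minkowski_def by blast

lemma zero_mem_minkowski:
  "(\<lambda>_. 0) \<in> minkowski A B \<longleftrightarrow> (\<lambda>_. 0) \<in> A \<and> (\<lambda>_. 0) \<in> B"
proof
  assume "(\<lambda>_. 0) \<in> minkowski A B"
  then obtain a b where ab: "(\<lambda>i. a i + b i) = (\<lambda>_. 0)" "a \<in> A" "b \<in> B"
    unfolding minkowski_def by (elim CollectE exE conjE) (rule that, simp_all only:)
  have "a = (\<lambda>_. 0)" "b = (\<lambda>_. 0)"
    using fun_cong[OF ab(1)] by (simp_all add: fun_eq_iff)
  then show "(\<lambda>_. 0) \<in> A \<and> (\<lambda>_. 0) \<in> B" using ab by simp
next
  assume "(\<lambda>_. 0) \<in> A \<and> (\<lambda>_. 0) \<in> B"
  then show "(\<lambda>_. 0) \<in> minkowski A B" using minkowskiI[of "\<lambda>_. 0" A "\<lambda>_. 0" B] by simp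
qed

lemma zero_mem_mink_pow: "(\<lambda>_. 0) \<in> mink_pow X k \<longleftrightarrow> k = 0 \<or> (\<lambda>_. 0) \<in> X"
  by (induction k) (auto simp: mink_pow_def zero_mem_minkowski)

lemma zero_mem_Theta_trop: "(\<lambda>_. 0) \<in> Theta_trop J T \<longleftrightarrow> J \<in> T"
proof
  assume "(\<lambda>_. 0) \<in> Theta_trop J T"
  then obtain s where s: "(\<lambda>_. 0) = (\<lambda>i. s i - J i)" "s \<in> T" "\<And>i. J i \<le> s i"
    by (auto simp: Theta_trop_def)
  have "s i = J i" for i using fun_cong[OF s(1), of i] s(3)[of i] by simp
  then show "J \<in> T" using s(2) by (metis ext)
qed (auto simp: Theta_trop_def intro!: exI[of _ J])

text \<open>The Minkowski sum in \<open>eps\<close> before vertices are taken, with the set of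
  variables as a parameter for induction.\<close>

definition eps_set :: "('n, 'm) dmono \<Rightarrow> ('n \<Rightarrow> ('m \<Rightarrow> nat) set) \<Rightarrow> ('n \<times> ('m \<Rightarrow> nat)) set \<Rightarrow> ('m \<Rightarrow> nat) set" where
  "eps_set M S V = Finite_Set.fold
     (\<lambda>v Y. minkowski (mink_pow (Theta_trop (snd v) (S (fst v))) (Poly_Mapping.lookup M v)) Y)
     {\<lambda>_. 0} V"

lemma eps_eq: "eps M S = Vert (eps_set M S (Poly_Mapping.keys M))"
  by (simp add: eps_def eps_set_def)

lemma eps_set_empty: "eps_set M S {} = {\<lambda>_. 0}"
  by (simp add: eps_set_def)

lemma eps_set_insert:
  assumes "finite V" "v \<notin> V"
  shows "eps_set M S (insert v V) =
    minkowski (mink_pow (Theta_trop (snd v) (S (fst v))) (Poly_Mapping.lookup M v)) (eps_set M S V)"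
proof -
  interpret comp_fun_commute
    "\<lambda>v Y. minkowski (mink_pow (Theta_trop (snd v) (S (fst v))) (Poly_Mapping.lookup M v)) Y"
    by standard (simp add: fun_eq_iff minkowski_left_commute)
  show ?thesis using assms unfolding eps_set_def by (rule fold_insert)
qed

lemma zero_mem_eps: "(\<lambda>_. 0) \<in> eps M S \<longleftrightarrow> (\<forall>v\<in>Poly_Mapping.keys M. snd v \<in> S (fst v))"
proof -
  have "finite V \<Longrightarrow> (\<lambda>_. 0) \<in> eps_set M S V \<longleftrightarrow> (\<forall>v\<in>V. Poly_Mapping.lookup M v = 0 \<or> snd v \<in> S (fst v))"
    for V
    by (induction V rule: finite_induct)
      (simp_all add: eps_set_empty eps_set_insert zero_mem_minkowski zero_mem_mink_pow zero_mem_Theta_trop)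
  then show ?thesis by (auto simp: eps_eq zero_mem_Vert in_keys_iff)
qed

text \<open>The tropical counterpart of a term surviving both \<open>t = 0\<close> and the vanishing
  of the variables outside \<open>S\<close>.\<close>

lemma zero_mem_trop_product:
  "(\<lambda>_. 0) \<in> minkowski (trop_series f) (eps M S) \<longleftrightarrow> f (\<lambda>_. 0) \<noteq> 0 \<and> (\<forall>v\<in>Poly_Mapping.keys M. snd v \<in> S (fst v))"
  by (simp add: zero_mem_minkowski trop_series_def zero_mem_Vert zero_mem_eps Supp_def)

section \<open>Supports of products and powers\<close>

text \<open>Here \<open>A\<close> is the exponent set expected if nothing cancels; cancellation is
  tolerated except at its vertices.\<close>

definition faithful :: "('m::finite, 'a::zero) series \<Rightarrow> ('m \<Rightarrow> nat) set \<Rightarrow> bool" where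
  "faithful f A \<longleftrightarrow> Supp f \<subseteq> A \<and> Vert A \<subseteq> Supp f"

lemma faithful_Supp: "faithful f (Supp f)"
  by (simp add: faithful_def Vert_subset)

text \<open>A vertex of a Minkowski sum has a unique decomposition, so no cancellation occurs there.\<close>

lemma faithful_mult:
  fixes f g :: "('m::finite, 'a::idom) series"
  assumes f: "faithful f A" and g: "faithful g B"
  shows "faithful (series_mult f g) (minkowski A B)"
  unfolding faithful_def
proof (intro conjI subsetI)
  fix J assume "J \<in> Supp (series_mult f g)"
  then have "(\<Sum>(a, b)\<in>decomp J. f a * g b) \<noteq> 0" by (simp add: Supp_def series_mult_decomp)
  then obtain a b where "(a, b) \<in> decomp J" "f a * g b \<noteq> 0"
    by (metis (mono_tags, lifting) sum.neutral case_prod_beta surj_pair fst_conv snd_conv)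
  then have "a \<in> A" "b \<in> B" "J = (\<lambda>i. a i + b i)"
    using f g by (auto simp: faithful_def Supp_def decomp_def)
  then show "J \<in> minkowski A B" by (auto simp: minkowski_def)
next
  fix J assume J: "J \<in> Vert (minkowski A B)"
  then have "J \<in> minkowski A B" using Vert_subset by blast
  then obtain a b where ab: "J = (\<lambda>i. a i + b i)" "a \<in> A" "b \<in> B" by (auto simp: minkowski_def)
  have "a \<in> Vert A" "b \<in> Vert B"
    using J Vert_minkowski_left[of a b A B] Vert_minkowski_right[of a b A B] ab by auto
  then have nz: "f a \<noteq> 0" "g b \<noteq> 0" using f g by (auto simp: faithful_def Supp_def)
  have "f a' * g b' = 0" if "(a', b') \<in> decomp J" "(a', b') \<noteq> (a, b)" for a' b'
  proof (rule ccontr)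
    assume "f a' * g b' \<noteq> 0"
    then have "a' \<in> A" "b' \<in> B" using f g by (auto simp: faithful_def Supp_def)
    have eq: "(\<lambda>i. a i + b i) = (\<lambda>i. a' i + b' i)" using that(1) ab(1) by (simp add: decomp_def)
    have "a = a'"
      by (rule Vert_minkowski_unique[OF _ ab(2,3) \<open>a' \<in> A\<close> \<open>b' \<in> B\<close> eq]) (use J ab(1) in simp)
    moreover have "b i = b' i" for i using fun_cong[OF eq, of i] \<open>a = a'\<close> by simp
    ultimately show False using that(2) by auto
  qed
  then have "(\<Sum>(a, b)\<in>decomp J. f a * g b) = (\<Sum>(a, b)\<in>{(a, b)}. f a * g b)"
  proof (intro sum.mono_neutral_right finite_decomp ballI)
    show "{(a, b)} \<subseteq> decomp J" using ab(1) by (simp add: decomp_def)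
    show "(case p of (a, b) \<Rightarrow> f a * g b) = 0" if "p \<in> decomp J - {(a, b)}" for p
      using that \<open>\<And>a' b'. (a', b') \<in> decomp J \<Longrightarrow> (a', b') \<noteq> (a, b) \<Longrightarrow> f a' * g b' = 0\<close> by (cases p) auto
  qed
  then show "J \<in> Supp (series_mult f g)" using nz by (simp add: Supp_def series_mult_decomp)
qed

lemma faithful_one: "faithful (series_one :: ('m::finite, 'a::idom) series) {\<lambda>_. 0}"
proof -
  have "Supp (series_one :: ('m, 'a) series) = {\<lambda>_. 0}"
    by (auto simp: Supp_def series_one_def fun_eq_iff)
  then show ?thesis using faithful_Supp by metis
qed

lemma faithful_pow: "faithful (f :: ('m::finite, 'a::idom) series) A \<Longrightarrow> faithful (series_pow f k) (mink_pow A k)"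
  by (induction k) (simp_all add: series_pow_def mink_pow_def faithful_one faithful_mult)

text \<open>In characteristic zero the factors from differentiation are nonzero, so
  \<open>Theta_trop\<close> describes supports exactly.\<close>

lemma Supp_Theta:
  fixes f :: "('m::finite, 'a::field_char_0) series"
  shows "Supp (Theta J f) = Theta_trop J (Supp f)"
proof (intro equalityI subsetI)
  fix A assume "A \<in> Supp (Theta J f)"
  then have "(\<lambda>i. A i + J i) \<in> Supp f" by (simp add: Theta_eq Supp_def)
  moreover have "A = (\<lambda>i. (A i + J i) - J i)" by simp
  ultimately show "A \<in> Theta_trop J (Supp f)"
    unfolding Theta_trop_def by (intro CollectI exI[of _ "\<lambda>i. A i + J i"]) auto
next
  fix A assume "A \<in> Theta_trop J (Supp f)"
  then obtain s where s: "A = (\<lambda>i. s i - J i)" "s \<in> Supp f" "\<And>i. J i \<le> s i"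
    by (auto simp: Theta_trop_def)
  then have "(\<lambda>i. A i + J i) = s" by auto
  moreover have "(\<Prod>k\<in>UNIV. pochhammer (Suc (A k)) (J k)) \<noteq> 0"
    by (simp add: pochhammer_pos)
  ultimately show "A \<in> Supp (Theta J f)" using s(2) unfolding Theta_eq Supp_def
    by (simp del: of_nat_prod)
qed

lemma faithful_eval_mono:
  fixes \<phi> :: "'n \<Rightarrow> ('m::finite, 'a::field_char_0) series"
  shows "faithful (eval_mono M \<phi>) (eps_set M (\<lambda>i. Supp (\<phi> i)) (Poly_Mapping.keys M))"
proof -
  have pow: "faithful (series_pow (Theta (snd v) (\<phi> (fst v))) k) (mink_pow (Theta_trop (snd v) (Supp (\<phi> (fst v)))) k)"
    for v k
    by (intro faithful_pow) (metis Supp_Theta faithful_Supp)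
  have "finite V \<Longrightarrow> faithful (coef (\<Prod>v\<in>V. jet \<phi> v ^ Poly_Mapping.lookup M v)) (eps_set M (\<lambda>i. Supp (\<phi> i)) V)"
    for V
  proof (induction V rule: finite_induct)
    case (insert v V)
    then show ?case
      using faithful_mult[OF pow insert.IH] by (simp add: eps_set_insert times_mps.rep_eq jet_def Mps_pow[symmetric])
  qed (simp add: one_mps.rep_eq eps_set_empty faithful_one)
  then show ?thesis by (simp add: eval_mono_eq mono_val_def)
qed

lemma trop_solution_Supp:
  fixes \<phi> :: "'n \<Rightarrow> ('m::finite, 'a::field_char_0) series"
  assumes P: "is_dpoly P" and ev: "eval_poly P \<phi> = series_zero"
  shows "trop_solution P (\<lambda>i. Supp (\<phi> i))"
  unfolding trop_solution_def
proof
  let ?S = "\<lambda>i. Supp (\<phi> i)"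
  let ?Y = "\<lambda>M. minkowski (trop_series (P M)) (eps M ?S)"
  \<comment> \<open>\<open>?Y\<close> is the tropical term and \<open>?Z\<close> bounds the true
    support; they have the same vertices.\<close>
  let ?Z = "\<lambda>M. minkowski (Supp (P M)) (eps_set M ?S (Poly_Mapping.keys M))"
  fix J assume "J \<in> trop_eval P ?S"
  then have J: "J \<in> Vert (\<Union>M\<in>dsupp P. ?Y M)" by (simp add: trop_eval_def)
  define c where "c M = series_mult (P M) (eval_mono M \<phi>) J" for M
  have faith: "faithful (series_mult (P M) (eval_mono M \<phi>)) (?Z M)" for M
    by (rule faithful_mult[OF faithful_Supp faithful_eval_mono])
  have VY: "Vert (?Y M) = Vert (?Z M)" for M
    by (simp add: trop_series_def eps_eq Vert_minkowski_Vert)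
  have vert: "J \<in> Vert (?Y M)" if "M \<in> dsupp P" "J \<in> ?Y M" for M
    using Vert_anti_mono[OF J, of "?Y M"] that by blast
  have trop: "J \<in> trop_term P M ?S" if "M \<in> dsupp P" "J \<in> ?Y M" for M
    using vert[OF that] by (simp add: trop_term_def)
  have nz: "c M \<noteq> 0" if "M \<in> dsupp P" "J \<in> ?Y M" for M
    using vert[OF that] faith[of M] unfolding VY by (auto simp: faithful_def Supp_def c_def)
  \<comment> \<open>A nonzero coefficient puts \<open>J\<close> into the polyhedron of
    \<open>?Y M\<close>. If \<open>J\<close> were not in \<open>?Y M\<close> itself, the remaining
    exponents of the union would already generate it.\<close>
  have mem: "J \<in> ?Y M" if M: "M \<in> dsupp P" and "c M \<noteq> 0" for M
  proof (rule ccontr)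
    assume nJ: "J \<notin> ?Y M"
    have "J \<in> ?Z M" using faith[of M] that(2) by (auto simp: faithful_def Supp_def c_def)
    then have "to_realvec J \<in> newton (?Y M)"
      by (simp add: trop_series_def eps_eq newton_minkowski_Vert)
    also have "newton (?Y M) \<subseteq> newton ((\<Union>M\<in>dsupp P. ?Y M) - {J})"
      using nJ M by (intro newton_mono) blast
    finally show False using J by (simp add: Vert_def)
  qed
  have "J \<in> (\<Union>M\<in>dsupp P. ?Y M)" using J Vert_subset by blast
  then obtain M1 where M1: "M1 \<in> dsupp P" "J \<in> ?Y M1" by blast
  have sum0: "(\<Sum>M\<in>dsupp P. c M) = 0"
    using fun_cong[OF ev, of J] by (simp add: eval_poly_def c_def series_zero_def)
  \<comment> \<open>The coefficients \<open>c M\<close> sum to zero and the one of \<open>M1\<close>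
    is nonzero, so another must compensate it.\<close>
  have "\<exists>M2\<in>dsupp P. M2 \<noteq> M1 \<and> c M2 \<noteq> 0"
  proof (rule ccontr)
    assume *: "\<not> ?thesis"
    have "(\<Sum>M\<in>dsupp P. c M) = (\<Sum>M\<in>{M1}. c M)"
      using * M1 P by (intro sum.mono_neutral_right) (auto simp: is_dpoly_def)
    then show False using sum0 nz[OF M1] by simp
  qed
  then obtain M2 where M2: "M2 \<in> dsupp P" "M2 \<noteq> M1" "c M2 \<noteq> 0" by blast
  then show "\<exists>M1\<in>dsupp P. \<exists>M2\<in>dsupp P. M1 \<noteq> M2 \<and> J \<in> trop_term P M1 ?S \<and> J \<in> trop_term P M2 ?S"
    using M1 trop[OF M1] trop[OF M2(1) mem[OF M2(1,3)]] by metis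
qed

section \<open>From tropical solutions to power series\<close>

text \<open>The coefficients outside \<open>V\<close> are left free, which amounts to setting the variables outside
  \<open>V\<close> to zero.\<close>

definition initial_ideal ::
  "('n, 'm::finite, 'a::comm_ring_1) dpoly set \<Rightarrow> ('n \<times> ('m \<Rightarrow> nat)) set \<Rightarrow> (('n, 'm) dmono \<Rightarrow>\<^sub>0 'a) set" where
  "initial_ideal G V = {f. \<exists>P\<in>G. \<forall>M. Poly_Mapping.keys M \<subseteq> V \<longrightarrow> Poly_Mapping.lookup f M = P M (\<lambda>_. 0)}"

text \<open>Every factor of a monomial over \<open>V\<close> is again over \<open>V\<close>, so the
  free coefficients never reach the coefficients that are constrained.\<close>

lemma is_ideal_initial_ideal:
  fixes G :: "('n, 'm::finite, 'a::comm_ring_1) dpoly set"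
  assumes G: "differential_ideal G"
  shows "is_ideal (initial_ideal G V)"
  unfolding is_ideal_def
proof (intro conjI ballI allI)
  have "poly_zero \<in> G" using G by (simp add: differential_ideal_def)
  then show "0 \<in> initial_ideal G V"
    unfolding initial_ideal_def by (intro CollectI bexI[of _ poly_zero]) (simp add: poly_zero_def series_zero_def)
  fix f assume "f \<in> initial_ideal G V"
  then obtain P where P: "P \<in> G" "\<And>M. Poly_Mapping.keys M \<subseteq> V \<Longrightarrow> Poly_Mapping.lookup f M = P M (\<lambda>_. 0)"
    by (auto simp: initial_ideal_def)
  show "f + g \<in> initial_ideal G V" if "g \<in> initial_ideal G V" for g
  proof -
    obtain Q where Q: "Q \<in> G" "\<And>M. Poly_Mapping.keys M \<subseteq> V \<Longrightarrow> Poly_Mapping.lookup g M = Q M (\<lambda>_. 0)"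
      using \<open>g \<in> initial_ideal G V\<close> by (auto simp: initial_ideal_def)
    have "poly_add P Q \<in> G" using G P(1) Q(1) by (simp add: differential_ideal_def)
    then show ?thesis
      unfolding initial_ideal_def using P Q by (intro CollectI bexI[of _ "poly_add P Q"]) (simp_all add: poly_add_def lookup_add)
  qed
  show "r * f \<in> initial_ideal G V" for r
  proof -
    \<comment> \<open>The multiplier \<open>r\<close> as a differential polynomial with constant
      coefficients, so that the product stays in \<open>G\<close>.\<close>
    define R :: "('n, 'm, 'a) dpoly" where "R = (\<lambda>M J. if J = (\<lambda>_. 0) then Poly_Mapping.lookup r M else 0)"
    have dR: "dsupp R = Poly_Mapping.keys r"
      by (auto simp: dsupp_def R_def series_zero_def fun_eq_iff in_keys_iff)
    have "poly_mul R P \<in> G" using G P(1) dR by (simp add: differential_ideal_def is_dpoly_def)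
    moreover have "Poly_Mapping.lookup (r * f) N = poly_mul R P N (\<lambda>_. 0)" if N: "Poly_Mapping.keys N \<subseteq> V"
      for N
    proof -
      define T where "T = Poly_Mapping.keys f \<union> dsupp P"
      have T: "finite T" using G P(1) by (auto simp: T_def differential_ideal_def is_dpoly_def)
      have "Poly_Mapping.lookup (r * f) N = (\<Sum>M\<in>Poly_Mapping.keys r. \<Sum>M'\<in>T.
          if M + M' = N then Poly_Mapping.lookup r M * Poly_Mapping.lookup f M' else 0)"
        unfolding lookup_mult_keys using T by (intro sum.cong refl sum.mono_neutral_left) (auto simp: T_def in_keys_iff)
      also have "\<dots> = (\<Sum>M\<in>Poly_Mapping.keys r. \<Sum>M'\<in>T.
          if M + M' = N then Poly_Mapping.lookup r M * P M' (\<lambda>_. 0) else 0)"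
      proof (intro sum.cong refl if_cong)
        fix M M' assume "M + M' = N"
        then have "Poly_Mapping.keys M' \<subseteq> Poly_Mapping.keys N" by (auto simp: in_keys_iff lookup_add)
        then have "Poly_Mapping.keys M' \<subseteq> V" using N by blast
        then show "Poly_Mapping.lookup r M * Poly_Mapping.lookup f M' = Poly_Mapping.lookup r M * P M' (\<lambda>_. 0)"
          using P(2) by simp
      qed
      also have "\<dots> = (\<Sum>M\<in>Poly_Mapping.keys r. \<Sum>M'\<in>dsupp P.
          if M + M' = N then Poly_Mapping.lookup r M * P M' (\<lambda>_. 0) else 0)"
        using T by (intro sum.cong refl sum.mono_neutral_right) (auto simp: T_def dsupp_def series_zero_def)
      also have "\<dots> = poly_mul R P N (\<lambda>_. 0)"
        unfolding poly_mul_def dR series_mult_zero_exp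
        by (simp add: sum.cartesian_product case_prod_beta R_def cong: if_cong)
      finally show ?thesis .
    qed
    ultimately show ?thesis unfolding initial_ideal_def by (intro CollectI bexI[of _ "poly_mul R P"]) auto
  qed
qed

lemma monomial_notin_initial_ideal:
  fixes G :: "('n, 'm::finite, 'a::comm_ring_1) dpoly set"
  assumes S: "S \<in> Sol_trop G" and V: "V = {v. snd v \<in> S (fst v)}" and M: "Poly_Mapping.keys M \<subseteq> V"
  shows "Poly_Mapping.single M 1 \<notin> initial_ideal G V"
proof
  assume "Poly_Mapping.single M 1 \<in> initial_ideal G V"
  then obtain P where P: "P \<in> G"
    "\<And>N. Poly_Mapping.keys N \<subseteq> V \<Longrightarrow> Poly_Mapping.lookup (Poly_Mapping.single M 1) N = P N (\<lambda>_. 0)"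
    by (auto simp: initial_ideal_def)
  have "P M (\<lambda>_. 0) \<noteq> 0" using P(2)[OF M] by simp
  moreover from this have "M \<in> dsupp P" by (auto simp: dsupp_def series_zero_def)
  ultimately have "(\<lambda>_. 0) \<in> trop_eval P S"
    using M by (auto simp: trop_eval_def zero_mem_Vert zero_mem_trop_product V)
  then obtain M1 M2 where "M1 \<noteq> M2" "(\<lambda>_. 0) \<in> trop_term P M1 S" "(\<lambda>_. 0) \<in> trop_term P M2 S"
    using S P(1) by (fastforce simp: Sol_trop_def trop_solution_def)
  \<comment> \<open>A term reaching the origin is supported on \<open>V\<close> with nonzero
    constant coefficient, and there the constant coefficients of \<open>P\<close> are those of the
    single monomial \<open>M\<close>.\<close>
  moreover have "N = M" if "(\<lambda>_. 0) \<in> trop_term P N S" for N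
  proof -
    have "P N (\<lambda>_. 0) \<noteq> 0" "Poly_Mapping.keys N \<subseteq> V"
      using that by (auto simp: trop_term_def zero_mem_Vert zero_mem_trop_product V)
    then show ?thesis using P(2)[of N] by (auto simp: lookup_single when_def split: if_splits)
  qed
  ultimately show False by blast
qed

lemma Theta_at_zero:
  "Theta J f (\<lambda>_. 0) = of_nat (\<Prod>k\<in>UNIV. fact (J k)) * f J"
  by (simp add: Theta_eq pochhammer_fact)

theorem mainTheorem11:
  fixes G :: "('n::finite, 'm::finite, 'a::{alg_closed_field, field_char_0}) dpoly set"
    and S :: "'n \<Rightarrow> ('m \<Rightarrow> nat) set"
  assumes "uncountable (UNIV :: 'a set)"
    and "differential_ideal G"
  shows "S \<in> Sol_trop G \<longleftrightarrow> (\<exists>\<phi>\<in>Sol G. (\<lambda>i. Supp (\<phi> i)) = S)"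
proof
  assume "\<exists>\<phi>\<in>Sol G. (\<lambda>i. Supp (\<phi> i)) = S"
  then obtain \<phi> where \<phi>: "\<phi> \<in> Sol G" "S = (\<lambda>i. Supp (\<phi> i))" by blast
  then show "S \<in> Sol_trop G"
    using assms(2) trop_solution_Supp[of _ \<phi>] by (auto simp: Sol_trop_def Sol_def differential_ideal_def)
next
  assume S: "S \<in> Sol_trop G"
  define V where "V = {v. snd v \<in> S (fst v)}"
  have "\<exists>c. (\<forall>v\<in>V. c v \<noteq> 0) \<and>
      (\<forall>f\<in>initial_ideal G V. (\<Sum>M\<in>Poly_Mapping.keys f. Poly_Mapping.lookup f M * mono_val c M) = 0)"
    by (rule torus_Nullstellensatz[OF assms(1) is_ideal_initial_ideal[OF assms(2)] monomial_notin_initial_ideal[OF S V_def]])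
  then obtain c where "\<forall>v\<in>V. c v \<noteq> 0"
      "\<forall>f\<in>initial_ideal G V. (\<Sum>M\<in>Poly_Mapping.keys f. Poly_Mapping.lookup f M * mono_val c M) = 0"
    by (elim exE conjE) (rule that)
  then have c: "\<And>v. v \<in> V \<Longrightarrow> c v \<noteq> 0"
    "\<And>f. f \<in> initial_ideal G V \<Longrightarrow> (\<Sum>M\<in>Poly_Mapping.keys f. Poly_Mapping.lookup f M * mono_val c M) = 0"
    by simp_all
  define d where "d v = (if v \<in> V then c v else 0)" for v
  define \<phi> where "\<phi> = (\<lambda>i J. d (i, J) / of_nat (\<Prod>k\<in>UNIV. fact (J k)))"
  have fact_nz: "(of_nat (\<Prod>k\<in>UNIV. fact (J k)) :: 'a) \<noteq> 0" for J :: "'m \<Rightarrow> nat" by simp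
  have "Theta (snd v) (\<phi> (fst v)) (\<lambda>_. 0) = d v" for v
    using fact_nz[of "snd v"] by (simp add: Theta_at_zero \<phi>_def del: of_nat_prod)
  then have ev0: "eval_poly P \<phi> (\<lambda>_. 0) = (\<Sum>M\<in>dsupp P. P M (\<lambda>_. 0) * mono_val d M)" if "is_dpoly P" for P
    using eval_poly_at_zero[OF that, of \<phi>] by simp
  have mv: "mono_val d M = (if Poly_Mapping.keys M \<subseteq> V then mono_val c M else 0)" for M
  proof (cases "Poly_Mapping.keys M \<subseteq> V")
    case True
    then show ?thesis by (auto simp: mono_val_def d_def intro!: prod.cong)
  next
    case False
    then obtain v where "v \<in> Poly_Mapping.keys M" "v \<notin> V" by blast
    then show ?thesis using False by (auto simp: mono_val_def d_def in_keys_iff intro!: prod_zero bexI[of _ v])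
  qed
  have "eval_poly P \<phi> (\<lambda>_. 0) = 0" if P: "P \<in> G" for P
  proof -
    have dP: "is_dpoly P" using P assms(2) by (simp add: differential_ideal_def)
    \<comment> \<open>\<open>P\<close> at \<open>t = 0\<close>, cut down to the monomials over
      \<open>V\<close>; by \<open>mv\<close> the discarded monomials vanish at
      \<open>d\<close>.\<close>
    define f where "f = Abs_poly_mapping (\<lambda>M. if Poly_Mapping.keys M \<subseteq> V then P M (\<lambda>_. 0) else 0)"
    have sub: "{M. (if Poly_Mapping.keys M \<subseteq> V then P M (\<lambda>_. 0) else 0) \<noteq> 0} \<subseteq> dsupp P"
      by (auto simp: dsupp_def series_zero_def)
    have f: "Poly_Mapping.lookup f = (\<lambda>M. if Poly_Mapping.keys M \<subseteq> V then P M (\<lambda>_. 0) else 0)"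
      unfolding f_def by (rule lookup_Abs_poly_mapping[OF finite_subset[OF sub dP[unfolded is_dpoly_def]]])
    have "f \<in> initial_ideal G V"
      unfolding initial_ideal_def by (intro CollectI bexI[of _ P]) (simp_all add: f P)
    have "eval_poly P \<phi> (\<lambda>_. 0) = (\<Sum>M\<in>dsupp P. Poly_Mapping.lookup f M * mono_val c M)"
      unfolding ev0[OF dP] by (intro sum.cong refl) (simp add: mv f)
    also have "\<dots> = (\<Sum>M\<in>Poly_Mapping.keys f. Poly_Mapping.lookup f M * mono_val c M)"
    proof (rule sum.mono_neutral_right)
      show "finite (dsupp P)" using dP by (simp add: is_dpoly_def)
      show "Poly_Mapping.keys f \<subseteq> dsupp P" using sub by (simp add: keys.rep_eq f)
    qed (simp add: in_keys_iff)
    also have "\<dots> = 0" by (rule c(2)) fact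
    finally show ?thesis .
  qed
  then have "eval_poly P \<phi> = series_zero" if "P \<in> G" for P
    using that assms(2) by (intro eval_poly_eq_zeroI[of G]) (simp_all add: differential_ideal_def)
  then have "\<phi> \<in> Sol G" by (simp add: Sol_def)
  moreover have "(\<lambda>i. Supp (\<phi> i)) = S"
  proof (intro ext set_eqI)
    fix i J
    have "J \<in> Supp (\<phi> i) \<longleftrightarrow> d (i, J) \<noteq> 0" using fact_nz[of J] by (simp add: Supp_def \<phi>_def)
    also have "\<dots> \<longleftrightarrow> J \<in> S i" using c(1)[of "(i, J)"] by (auto simp: d_def V_def)
    finally show "J \<in> Supp (\<phi> i) \<longleftrightarrow> J \<in> S i" .
  qed
  ultimately show "\<exists>\<phi>\<in>Sol G. (\<lambda>i. Supp (\<phi> i)) = S" by (intro bexI[of _ \<phi>])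
qed

end
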